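(* In the discrete-time setting described in the context, let $\mathcal U\subseteq\prod_{k=0}^{N-1}(L^2_{\mathcal F_k})^m$ be nonempty and closed, and suppose $(\bar x,\bar u)$ is a local solution of $$\min\ \mathbb E\Big(\sum_{k=0}^{N-1}\ell(k,x_k,u_k)+\Phi(x_N)\Big)\ \text{s.t. } x_{k+1}=b(k,x_k,u_k)+\sigma(k,x_k,u_k)w_{k+1}\ (k=0,\dots,N-1),\ x_0=\hat x_0,\ x\in\prod_{k=0}^NX_k,\ u\in\mathcal U.$$ Then there exist $p\in\prod_{k=0}^{N-1}(L^2_{\mathcal F_k})^n$ and $q\in\prod_{k=0}^{N-1}(L^2_{\mathcal F_k})^{n\times d}$ such that $$p_{k-1}=\mathbb E\big(\nabla_xH(k,\bar x_k,p_k,q_k,\bar u_k)\,|\,\mathcal F_{k-1}\big),\quad q^i_{k-1}=\mathbb E\big(\nabla_xH(k,\bar x_k,p_k,q_k,\bar u_k)w_k^i\,|\,\mathcal F_{k-1}\big)$$ for all $k\in\{1,\dots,N-1\}$ and $i\in\{1,\dots,d\}$, $$p_{N-1}=\mathbb E(\nabla\Phi(\bar x_N)|\mathcal F_{N-1}),\quad q^i_{N-1}=\mathbb E(\nabla\Phi(\bar x_N)w_N^i|\mathcal F_{N-1})\ \ (i=1,\dots,d),$$ and $$\mathbb E\Big(\sum_{k=0}^{N-1}\nabla_uH(k,\bar x_k,p_k,q_k,\bar u_k)\cdot v_k\Big)\ge0\quad\forall v\in T_{\mathcal U}(\bar u).$$ If in addition $K(\mathcal U,\bar u)$ is convex, the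 last inequality holds for all $v\in K(\mathcal U,\bar u)$.
   Context: $(\Omega,\mathcal F,\mathbb P)$ is a probability space; $w_1,\dots,w_N$ are independent $\mathbb R^d$-valued random variables with independent coordinates, $\mathbb E(w_k^i)=0$, $\mathbb E|w_k^i|^2=1$; $w_0:=0$, $\mathcal F_k=\sigma(w_0,\dots,w_k)$, $L^2_{\mathcal F_k}$ the $\mathcal F_k$-measurable square-integrable random variables. $X_0=\mathbb R^n$ and $X_k=\{y^0+\sum_{i=1}^dy^iw_k^i:y^i\in(L^2_{\mathcal F_{k-1}})^n\}$ for $k\ge1$, normed by $\|x\|_{X_k}^2=\mathbb E|x|^2$; products carry sums of norms; local solution means minimal cost among feasible pairs in a neighbourhood in $\prod_kX_k\times\prod_k(L^2_{\mathcal F_k})^m$. $\hat x_0\in\mathbb R^n$. Data $b:\{0,\dots,N-1\}\times\mathbb R^n\times\mathbb R^m\to\mathbb R^n$, $\sigma:\ldots\to\mathbb R^{n\times d}$ (columns $\sigma^i$), $\ell:\{0,\dots,N-1\}\times\mathbb R^n\times\mathbb R^m\to\mathbb R$, $\Phi:\mathbb R^n\to\mathbb R$ are Borel measurable and $C^1$ in $(x,u)$ (resp. $x$), with $c_1,c_2>0$ such that for $\psi\in\{b,\sigma^i\}$: $|\psi(k,x,u)|\le c_1(1+|x|+|u|)$, $|\psi_x|+|\psi_u|\le c_1$; and $|\ell|\le c_2(1+|x|+|u|)^2$, $|\ell_x|+|\ell_u|\le c_2(1+|x|+|u|)$, $|\Phi(x)|\le c_2(1+|x|)^2$, $|\Phi_x|\le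 c_2(1+|x|)$. Hamiltonian $H(k,x,p,q,u)=\ell(k,x,u)+p\cdot b(k,x,u)+\sum_{i=1}^dq^i\cdot\sigma^i(k,x,u)$, $q^i$ the $i$-th column of $q$. In the Hilbert space $\prod_k(L^2_{\mathcal F_k})^m$: $T_{\mathcal U}(\bar u)=\{v:\lim_{w\to\bar u,\,w\in\mathcal U,\,\tau\to0^+}d_{\mathcal U}(w+\tau v)/\tau=0\}$ (Clarke tangent cone), $K(\mathcal U,\bar u)=\{v:\liminf_{\tau\to0^+}d_{\mathcal U}(\bar u+\tau v)/\tau=0\}$ (contingent cone). *)

theory Defs
  imports "HOL-Analysis.Analysis" "HOL-Probability.Probability"
begin

definition C1_map :: "('a::real_normed_vector \<Rightarrow> 'b::real_normed_vector) \<Rightarrow> bool" where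
  "C1_map f \<longleftrightarrow> (\<exists>D. (\<forall>z. (f has_derivative blinfun_apply (D z)) (at z)) \<and> continuous_on UNIV D)"

definition Dx :: "('x::real_normed_vector \<Rightarrow> 'u \<Rightarrow> 'b::real_normed_vector) \<Rightarrow> 'x \<Rightarrow> 'u \<Rightarrow> 'x \<Rightarrow> 'b" where
  "Dx f x u = frechet_derivative (\<lambda>x'. f x' u) (at x)"

definition Du :: "('x \<Rightarrow> 'u::real_normed_vector \<Rightarrow> 'b::real_normed_vector) \<Rightarrow> 'x \<Rightarrow> 'u \<Rightarrow> 'u \<Rightarrow> 'b" where
  "Du f x u = frechet_derivative (\<lambda>u'. f x u') (at u)"

definition grad :: "(real^'n \<Rightarrow> real) \<Rightarrow> real^'n \<Rightarrow> real^'n" where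
  "grad f x = (\<chi> j. frechet_derivative f (at x) (axis j 1))"

text \<open>\<open>\<sigma> k x u $ i\<close> is the i-th column \<open>\<sigma>\<^sup>i\<close> of the \<open>n\<times>d\<close> matrix; likewise \<open>q $ i\<close> is \<open>q\<^sup>i\<close>.\<close>
definition Ham ::
  "(nat \<Rightarrow> real^'n \<Rightarrow> real^'m \<Rightarrow> real) \<Rightarrow> (nat \<Rightarrow> real^'n \<Rightarrow> real^'m \<Rightarrow> real^'n)
   \<Rightarrow> (nat \<Rightarrow> real^'n \<Rightarrow> real^'m \<Rightarrow> real^'n^'d::finite)
   \<Rightarrow> nat \<Rightarrow> real^'n \<Rightarrow> real^'n \<Rightarrow> real^'n^'d \<Rightarrow> real^'m \<Rightarrow> real" where
  "Ham ell b \<sigma> k x p q u = ell k x u + p \<bullet> b k x u + (\<Sum>i\<in>UNIV. (q $ i) \<bullet> (\<sigma> k x u $ i))"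

definition gradx_Ham where
  "gradx_Ham ell b \<sigma> k x p q u = grad (\<lambda>x'. Ham ell b \<sigma> k x' p q u) x"

definition gradu_Ham where
  "gradu_Ham ell b \<sigma> k x p q u = grad (\<lambda>u'. Ham ell b \<sigma> k x p q u') u"

text \<open>\<open>\<F>\<^sub>k = \<sigma>(w\<^sub>0,\<dots>,w\<^sub>k)\<close> with \<open>w\<^sub>0 = 0\<close>, i.e. generated by \<open>w\<^sub>1,\<dots>,w\<^sub>k\<close>
  (for \<open>k = 0\<close> the trivial sigma algebra).\<close>
definition filt :: "'a measure \<Rightarrow> (nat \<Rightarrow> 'a \<Rightarrow> real^'d) \<Rightarrow> nat \<Rightarrow> 'a measure" where
  "filt M w k = sigma (space M) {w j -` A \<inter> space M | j A. j \<in> {1..k} \<and> A \<in> sets borel}"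

definition L2 :: "'a measure \<Rightarrow> 'a measure \<Rightarrow> ('a \<Rightarrow> 'b::euclidean_space) \<Rightarrow> bool" where
  "L2 M F f \<longleftrightarrow> f \<in> borel_measurable F \<and> integrable M (\<lambda>\<omega>. (norm (f \<omega>))\<^sup>2)"

definition L2norm :: "'a measure \<Rightarrow> ('a \<Rightarrow> 'b::euclidean_space) \<Rightarrow> real" where
  "L2norm M f = sqrt (\<integral>\<omega>. (norm (f \<omega>))\<^sup>2 \<partial>M)"

definition cond_exp_vec :: "'a measure \<Rightarrow> 'a measure \<Rightarrow> ('a \<Rightarrow> real^'n) \<Rightarrow> 'a \<Rightarrow> real^'n" where
  "cond_exp_vec M F f = (\<lambda>\<omega>. \<chi> j. real_cond_exp M F (\<lambda>\<omega>'. f \<omega>' $ j) \<omega>)"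

definition Xsp :: "'a measure \<Rightarrow> (nat \<Rightarrow> 'a \<Rightarrow> real^'d::finite) \<Rightarrow> nat \<Rightarrow> ('a \<Rightarrow> real^'n) set" where
  "Xsp M w k = {x. x \<in> borel_measurable M \<and>
     (if k = 0 then (\<exists>c. AE \<omega> in M. x \<omega> = c)
      else (\<exists>y0 y. L2 M (filt M w (k-1)) y0 \<and> (\<forall>i. L2 M (filt M w (k-1)) (y i)) \<and>
               (AE \<omega> in M. x \<omega> = y0 \<omega> + (\<Sum>i\<in>UNIV. (w k \<omega> $ i) *\<^sub>R y i \<omega>))))}"

text \<open>Elements of the control space \<open>\<Prod>\<^sub>k<N (L\<^sup>2\<^sub>F\<^sub>k)\<^sup>m\<close> (represented by functions;
  only indices \<open>k < N\<close> matter).\<close>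
definition adm :: "'a measure \<Rightarrow> (nat \<Rightarrow> 'a \<Rightarrow> real^'d) \<Rightarrow> nat \<Rightarrow> (nat \<Rightarrow> 'a \<Rightarrow> real^'m) \<Rightarrow> bool" where
  "adm M w N u \<longleftrightarrow> (\<forall>k<N. L2 M (filt M w k) (u k))"

definition cdist :: "'a measure \<Rightarrow> nat \<Rightarrow> (nat \<Rightarrow> 'a \<Rightarrow> real^'m) \<Rightarrow> (nat \<Rightarrow> 'a \<Rightarrow> real^'m) \<Rightarrow> real" where
  "cdist M N u v = (\<Sum>k<N. L2norm M (\<lambda>\<omega>. u k \<omega> - v k \<omega>))"

definition distU where
  "distU M N U z = Inf {cdist M N z u | u. u \<in> U}"

text \<open>A subset of the Hilbert space, represented as a set of representatives: it consists of
  admissible elements and is saturated under a.e. equality (i.e. it is a set of classes).\<close>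
definition ctrl_set where
  "ctrl_set M w N U \<longleftrightarrow> (\<forall>u\<in>U. adm M w N u) \<and>
     (\<forall>u\<in>U. \<forall>v. adm M w N v \<and> (\<forall>k<N. AE \<omega> in M. v k \<omega> = u k \<omega>) \<longrightarrow> v \<in> U)"

definition closed_ctrl where
  "closed_ctrl M w N U \<longleftrightarrow> (\<forall>s u. (\<forall>j. s j \<in> U) \<and> adm M w N u \<and>
       (\<lambda>j. cdist M N (s j) u) \<longlonglongrightarrow> 0 \<longrightarrow> u \<in> U)"

definition addc :: "(nat \<Rightarrow> 'a \<Rightarrow> real^'m) \<Rightarrow> real \<Rightarrow> (nat \<Rightarrow> 'a \<Rightarrow> real^'m) \<Rightarrow> nat \<Rightarrow> 'a \<Rightarrow> real^'m" where
  "addc u t v = (\<lambda>k \<omega>. u k \<omega> + t *\<^sub>R v k \<omega>)"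

definition clarke_cone where
  "clarke_cone M w N U ub = {v. adm M w N v \<and>
     (\<forall>\<epsilon>>0. \<exists>\<delta>>0. \<forall>z\<in>U. \<forall>\<tau>. cdist M N z ub < \<delta> \<and> 0 < \<tau> \<and> \<tau> < \<delta> \<longrightarrow>
        \<bar>distU M N U (addc z \<tau> v) / \<tau>\<bar> < \<epsilon>)}"

definition contingent_cone where
  "contingent_cone M w N U ub = {v. adm M w N v \<and>
     Liminf (at_right 0) (\<lambda>\<tau>. ereal (distU M N U (addc ub \<tau> v) / \<tau>)) = 0}"

definition convex_ctrl where
  "convex_ctrl K \<longleftrightarrow> (\<forall>v1\<in>K. \<forall>v2\<in>K. \<forall>t::real. 0 \<le> t \<and> t \<le> 1 \<longrightarrow>
      (\<lambda>k \<omega>. (1 - t) *\<^sub>R v1 k \<omega> + t *\<^sub>R v2 k \<omega>) \<in> K)"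

definition cost where
  "cost M N ell \<Phi> x u = (\<integral>\<omega>. (\<Sum>k<N. ell k (x k \<omega>) (u k \<omega>)) + \<Phi> (x N \<omega>) \<partial>M)"

definition feasible where
  "feasible M w N b \<sigma> x0 U x u \<longleftrightarrow>
     (\<forall>k\<le>N. x k \<in> Xsp M w k) \<and> u \<in> U \<and>
     (AE \<omega> in M. x 0 \<omega> = x0) \<and>
     (\<forall>k<N. AE \<omega> in M. x (Suc k) \<omega> =
          b k (x k \<omega>) (u k \<omega>) + (\<Sum>i\<in>UNIV. (w (Suc k) \<omega> $ i) *\<^sub>R (\<sigma> k (x k \<omega>) (u k \<omega>) $ i)))"

definition local_solution where
  "local_solution M w N b \<sigma> ell \<Phi> x0 U xb ub \<longleftrightarrow>
     feasible M w N b \<sigma> x0 U xb ub \<and>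
     (\<exists>\<epsilon>>0. \<forall>x u. feasible M w N b \<sigma> x0 U x u \<and>
        (\<Sum>k\<le>N. L2norm M (\<lambda>\<omega>. x k \<omega> - xb k \<omega>)) + cdist M N u ub < \<epsilon> \<longrightarrow>
        cost M N ell \<Phi> xb ub \<le> cost M N ell \<Phi> x u)"

end

theory Submission
  imports Defs
begin

text \<open>
  For each control \<open>u\<close> the state equation has a unique trajectory, so the problem reduces to the
  minimisation of a function of \<open>u\<close> alone. This function is Hadamard differentiable: if
  \<open>v j \<longlonglongrightarrow> v\<close> in \<open>L2\<close> and \<open>t j \<longlonglongrightarrow> 0\<close>, then the
  difference quotients of the trajectories for \<open>u + t j v j\<close> converge in \<open>L2\<close> to the solution of the
  linearised equation. Only the Lipschitz bounds, dominated convergence and the isometry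
  \<open>E|g w|\<^sup>2 = E|g|\<^sup>2\<close> for \<open>g\<close> independent of \<open>w\<close> are needed. A tangent vector \<open>v\<close> in either
  cone is a limit of directions \<open>v j\<close> with \<open>u + t j v j\<close> in \<open>U\<close>, hence the derivative in direction
  \<open>v\<close> is nonnegative. The adjoint pair \<open>(p, q)\<close> is the backward conditional expectation of the
  gradient of the Hamiltonian, and summation by parts turns the derivative into the integral of
  \<open>\<nabla>\<^sub>uH \<bullet> v\<close>.
\<close>

section \<open>Square integrable functions\<close>

text \<open>Superposition operators on \<open>L2\<close> are in general not Frechet differentiable,
  so differentiability is tested along sequences. The directions must be allowed to move for two
  reasons: the cones supply only approximating directions, and the difference quotient of the state
  at one time is itself a moving direction for the coefficients that produce the next state. The
  cost has a derivative of linear growth, so for it only the integrals of the quotients are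
  followed; the error is a product of an \<open>L2\<close> bounded factor and one that tends to 0.
  For the adjoint the obstacle is integrability. The gradient \<open>G\<close> at time
  \<open>k + 1\<close> depends on the noise of that time, of which only second moments are
  controlled, so noise times \<open>G\<close> is integrable but need not be square integrable. Its
  conditional expectation nevertheless lies in \<open>L2\<close>: multiplication by a noise
  coordinate is an isometry from the square integrable functions of the past into \<open>L2\<close>,
  and \<open>q\<close> is the adjoint of that operator applied to \<open>G\<close>. The same adjoint
  relation later moves the conditional expectations in the duality formula.\<close>

lemma norm_add_sq_le:
  fixes x y :: "'b::real_normed_vector"
  shows "(norm (x + y))\<^sup>2 \<le> 2 * (norm x)\<^sup>2 + 2 * (norm y)\<^sup>2"
proof -
  have "(norm (x + y))\<^sup>2 \<le> (norm x + norm y)\<^sup>2"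
    by (intro power_mono norm_triangle_ineq) auto
  also have "\<dots> \<le> 2 * (norm x)\<^sup>2 + 2 * (norm y)\<^sup>2"
    using sum_squares_bound[of "norm x" "norm y"] by (simp add: power2_sum)
  finally show ?thesis .
qed

lemma L2_measurable: "L2 M F f \<Longrightarrow> f \<in> borel_measurable F"
  by (simp add: L2_def)

lemma L2_integrable: "L2 M F f \<Longrightarrow> integrable M (\<lambda>\<omega>. (norm (f \<omega>))\<^sup>2)"
  by (simp add: L2_def)

lemma measurable_subalgebra:
  assumes "subalgebra G F" "f \<in> borel_measurable F"
  shows "f \<in> borel_measurable G"
  using assms measurable_from_subalg by blast

lemma L2_subalgebra: "subalgebra G F \<Longrightarrow> L2 M F f \<Longrightarrow> L2 M G f"
  by (auto simp: L2_def measurable_subalgebra)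

lemma subalgebra_refl: "subalgebra M M"
  by (simp add: subalgebra_def)

lemma L2_bound:
  assumes "subalgebra M F" and g: "integrable M (\<lambda>\<omega>. (g \<omega>)\<^sup>2)"
    and f: "f \<in> borel_measurable F" and le: "\<And>\<omega>. norm (f \<omega>) \<le> g \<omega>"
  shows "L2 M F f"
proof -
  have [measurable]: "f \<in> borel_measurable M"
    using measurable_subalgebra[OF assms(1) f] .
  have "integrable M (\<lambda>\<omega>. (norm (f \<omega>))\<^sup>2)"
    by (rule Bochner_Integration.integrable_bound[OF g]) (auto simp: le power_mono intro!: AE_I2)
  then show ?thesis using f by (simp add: L2_def)
qed

lemma L2_add:
  assumes "subalgebra M F" "L2 M F f" "L2 M F g"
  shows "L2 M F (\<lambda>\<omega>. f \<omega> + g \<omega>)"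
proof -
  have F[measurable]: "f \<in> borel_measurable F" "g \<in> borel_measurable F"
    using assms L2_measurable by auto
  have [measurable]: "f \<in> borel_measurable M" "g \<in> borel_measurable M"
    using measurable_subalgebra[OF assms(1) F(1)] measurable_subalgebra[OF assms(1) F(2)] by auto
  have "integrable M (\<lambda>\<omega>. (norm (f \<omega> + g \<omega>))\<^sup>2)"
    by (rule Bochner_Integration.integrable_bound[where
          f="\<lambda>\<omega>. 2 * (norm (f \<omega>))\<^sup>2 + 2 * (norm (g \<omega>))\<^sup>2"])
      (use assms norm_add_sq_le in \<open>auto simp: L2_def\<close>)
  then show ?thesis by (simp add: L2_def)
qed

lemma L2_scaleR:
  assumes "L2 M F f"
  shows "L2 M F (\<lambda>\<omega>. c *\<^sub>R f \<omega>)"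
  using assms by (auto simp: L2_def power_mult_distrib)

lemma L2_diff:
  assumes "subalgebra M F" "L2 M F f" "L2 M F g"
  shows "L2 M F (\<lambda>\<omega>. f \<omega> - g \<omega>)"
  using L2_add[OF assms(1,2) L2_scaleR[OF assms(3), of "-1"]] by simp

lemma L2_sum:
  assumes "subalgebra M F" "\<And>i. i \<in> I \<Longrightarrow> L2 M F (f i)"
  shows "L2 M F (\<lambda>\<omega>. \<Sum>i\<in>I. f i \<omega>)"
  using assms(2)
proof (induction I rule: infinite_finite_induct)
  case (insert x I)
  then show ?case by (simp add: L2_add[OF assms(1)])
qed (simp_all add: L2_def)

lemma L2_const: "finite_measure M \<Longrightarrow> L2 M F (\<lambda>\<omega>. c)"
  by (simp add: L2_def finite_measure.integrable_const)

lemma L2_norm: "L2 M F f \<Longrightarrow> L2 M F (\<lambda>\<omega>. norm (f \<omega>))"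
  by (auto simp: L2_def)

lemma L2_Pair:
  fixes f :: "'a \<Rightarrow> 'b::euclidean_space" and g :: "'a \<Rightarrow> 'c::euclidean_space"
  assumes "L2 M F f" "L2 M F g"
  shows "L2 M F (\<lambda>\<omega>. (f \<omega>, g \<omega>))"
  using assms by (auto simp: L2_def norm_Pair)

lemma integrable_norm_mult:
  assumes "L2 M M f" "L2 M M g"
  shows "integrable M (\<lambda>\<omega>. norm (f \<omega>) * norm (g \<omega>))"
proof (rule Bochner_Integration.integrable_bound[where f="\<lambda>\<omega>. (norm (f \<omega>))\<^sup>2 + (norm (g \<omega>))\<^sup>2"])
  have [measurable]: "f \<in> borel_measurable M" "g \<in> borel_measurable M"
    using assms L2_measurable by auto
  show "(\<lambda>\<omega>. norm (f \<omega>) * norm (g \<omega>)) \<in> borel_measurable M" by simp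
  have "norm (f \<omega>) * norm (g \<omega>) \<le> (norm (f \<omega>))\<^sup>2 + (norm (g \<omega>))\<^sup>2" for \<omega>
    using sum_squares_bound[of "norm (f \<omega>)" "norm (g \<omega>)"]
      mult_nonneg_nonneg[OF norm_ge_zero norm_ge_zero, of "f \<omega>" "g \<omega>"] by linarith
  then show "AE \<omega> in M. norm (norm (f \<omega>) * norm (g \<omega>)) \<le> norm ((norm (f \<omega>))\<^sup>2 + (norm (g \<omega>))\<^sup>2)"
    by auto
qed (use assms in \<open>auto simp: L2_def\<close>)

lemma integrable_mult_L2:
  fixes f g :: "'a \<Rightarrow> real"
  assumes "L2 M M f" "L2 M M g"
  shows "integrable M (\<lambda>\<omega>. f \<omega> * g \<omega>)"
  by (rule Bochner_Integration.integrable_bound[OF integrable_norm_mult[OF assms]])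
    (use assms in \<open>auto simp: L2_def abs_mult\<close>)

lemma integrable_inner_L2:
  assumes "L2 M M f" "L2 M M g"
  shows "integrable M (\<lambda>\<omega>. f \<omega> \<bullet> g \<omega>)"
  by (rule Bochner_Integration.integrable_bound[OF integrable_norm_mult[OF assms]])
    (use assms in \<open>auto simp: L2_def Cauchy_Schwarz_ineq2\<close>)

text \<open>Membership in \<open>L2\<close> is part of the notion because the Bochner integral of a
  non-integrable function is \<open>0\<close>.\<close>
definition L2_tendsto ::
  "'a measure \<Rightarrow> 'a measure \<Rightarrow> (nat \<Rightarrow> 'a \<Rightarrow> 'b::euclidean_space) \<Rightarrow> ('a \<Rightarrow> 'b) \<Rightarrow> bool" where
  "L2_tendsto M F f g \<longleftrightarrow> (\<forall>j. L2 M F (f j)) \<and> L2 M F g \<and>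
     (\<lambda>j. \<integral>\<omega>. (norm (f j \<omega> - g \<omega>))\<^sup>2 \<partial>M) \<longlonglongrightarrow> 0"

lemma L2_tendsto_dominated:
  assumes f: "\<And>j. L2 M F (f j)" and g: "L2 M F g"
    and h: "h \<longlonglongrightarrow> 0" "\<And>j. (\<integral>\<omega>. (norm (f j \<omega> - g \<omega>))\<^sup>2 \<partial>M) \<le> h j"
  shows "L2_tendsto M F f g"
proof -
  have "(\<lambda>j. \<integral>\<omega>. (norm (f j \<omega> - g \<omega>))\<^sup>2 \<partial>M) \<longlonglongrightarrow> 0"
    by (rule tendsto_sandwich[OF _ _ tendsto_const h(1)]) (auto simp: h(2))
  then show ?thesis using f g by (simp add: L2_tendsto_def)
qed

lemma L2_tendsto_subalgebra:
  "subalgebra G F \<Longrightarrow> L2_tendsto M F f g \<Longrightarrow> L2_tendsto M G f g"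
  by (auto simp: L2_tendsto_def L2_subalgebra)

lemma integral_norm_add_sq_le:
  assumes "L2 M M f" "L2 M M g"
  shows "(\<integral>\<omega>. (norm (f \<omega> + g \<omega>))\<^sup>2 \<partial>M)
     \<le> 2 * (\<integral>\<omega>. (norm (f \<omega>))\<^sup>2 \<partial>M) + 2 * (\<integral>\<omega>. (norm (g \<omega>))\<^sup>2 \<partial>M)"
proof -
  have "(\<integral>\<omega>. (norm (f \<omega> + g \<omega>))\<^sup>2 \<partial>M)
     \<le> (\<integral>\<omega>. 2 * (norm (f \<omega>))\<^sup>2 + 2 * (norm (g \<omega>))\<^sup>2 \<partial>M)"
    using assms L2_integrable[OF L2_add[OF subalgebra_refl assms]]
    by (intro integral_mono norm_add_sq_le) (auto simp: L2_def)
  also have "\<dots> = 2 * (\<integral>\<omega>. (norm (f \<omega>))\<^sup>2 \<partial>M) + 2 * (\<integral>\<omega>. (norm (g \<omega>))\<^sup>2 \<partial>M)"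
    using assms by (auto simp: L2_def)
  finally show ?thesis .
qed

lemma L2_tendsto_add:
  assumes F: "subalgebra M F" and "L2_tendsto M F f f'" "L2_tendsto M F g g'"
  shows "L2_tendsto M F (\<lambda>j \<omega>. f j \<omega> + g j \<omega>) (\<lambda>\<omega>. f' \<omega> + g' \<omega>)"
proof (rule L2_tendsto_dominated)
  let ?h = "\<lambda>j. 2 * (\<integral>\<omega>. (norm (f j \<omega> - f' \<omega>))\<^sup>2 \<partial>M) + 2 * (\<integral>\<omega>. (norm (g j \<omega> - g' \<omega>))\<^sup>2 \<partial>M)"
  have "?h \<longlonglongrightarrow> 2 * 0 + 2 * 0"
    using assms(2,3) unfolding L2_tendsto_def by (intro tendsto_intros) auto
  then show "?h \<longlonglongrightarrow> 0" by simp
  fix j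
  have "L2 M M (\<lambda>\<omega>. f j \<omega> - f' \<omega>)" "L2 M M (\<lambda>\<omega>. g j \<omega> - g' \<omega>)"
    using assms by (auto simp: L2_tendsto_def intro!: L2_subalgebra[OF F] L2_diff[OF F])
  from integral_norm_add_sq_le[OF this]
  show "(\<integral>\<omega>. (norm (f j \<omega> + g j \<omega> - (f' \<omega> + g' \<omega>)))\<^sup>2 \<partial>M) \<le> ?h j"
    by (simp add: algebra_simps)
qed (use assms in \<open>auto simp: L2_tendsto_def intro!: L2_add[OF F]\<close>)

lemma L2_tendsto_sum:
  assumes F: "subalgebra M F" and "\<And>i. i \<in> I \<Longrightarrow> L2_tendsto M F (f i) (g i)"
  shows "L2_tendsto M F (\<lambda>j \<omega>. \<Sum>i\<in>I. f i j \<omega>) (\<lambda>\<omega>. \<Sum>i\<in>I. g i \<omega>)"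
  using assms(2)
proof (induction I rule: infinite_finite_induct)
  case (insert x I)
  then show ?case by (simp add: L2_tendsto_add[OF F])
qed (simp_all add: L2_tendsto_def L2_def)

lemma L2_tendsto_Pair:
  fixes f :: "nat \<Rightarrow> 'a \<Rightarrow> 'b::euclidean_space" and g :: "nat \<Rightarrow> 'a \<Rightarrow> 'c::euclidean_space"
  assumes F: "subalgebra M F" and "L2_tendsto M F f f'" "L2_tendsto M F g g'"
  shows "L2_tendsto M F (\<lambda>j \<omega>. (f j \<omega>, g j \<omega>)) (\<lambda>\<omega>. (f' \<omega>, g' \<omega>))"
proof (rule L2_tendsto_dominated)
  let ?h = "\<lambda>j. (\<integral>\<omega>. (norm (f j \<omega> - f' \<omega>))\<^sup>2 \<partial>M) + (\<integral>\<omega>. (norm (g j \<omega> - g' \<omega>))\<^sup>2 \<partial>M)"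
  have "?h \<longlonglongrightarrow> 0 + 0"
    using assms(2,3) unfolding L2_tendsto_def by (intro tendsto_intros) auto
  then show "?h \<longlonglongrightarrow> 0" by simp
  fix j
  have "L2 M F (\<lambda>\<omega>. f j \<omega> - f' \<omega>)" "L2 M F (\<lambda>\<omega>. g j \<omega> - g' \<omega>)"
    using assms by (auto simp: L2_tendsto_def intro!: L2_diff[OF F])
  then show "(\<integral>\<omega>. (norm ((f j \<omega>, g j \<omega>) - (f' \<omega>, g' \<omega>)))\<^sup>2 \<partial>M) \<le> ?h j"
    by (simp add: norm_Pair L2_def)
qed (use assms in \<open>auto simp: L2_tendsto_def intro!: L2_Pair\<close>)

section \<open>Superposition operators and their difference quotients\<close>

lemma borel_measurable_deriv_apply:
  fixes D :: "'b::euclidean_space \<Rightarrow> 'b \<Rightarrow>\<^sub>L 'c::euclidean_space"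
  assumes D: "continuous_on UNIV D" and "Z \<in> borel_measurable F" "Y \<in> borel_measurable F"
  shows "(\<lambda>\<omega>. blinfun_apply (D (Z \<omega>)) (Y \<omega>)) \<in> borel_measurable F"
proof -
  have "continuous_on UNIV (\<lambda>p. blinfun_apply (D (fst p)) (snd p))"
    using D by (intro continuous_intros continuous_on_compose2[OF D]) auto
  then have "(\<lambda>p. blinfun_apply (D (fst p)) (snd p)) \<in> borel_measurable borel"
    by (rule borel_measurable_continuous_onI)
  moreover have "(\<lambda>\<omega>. (Z \<omega>, Y \<omega>)) \<in> borel_measurable F"
    using assms by (intro borel_measurable_Pair) auto
  ultimately have "(\<lambda>p. blinfun_apply (D (fst p)) (snd p)) \<circ> (\<lambda>\<omega>. (Z \<omega>, Y \<omega>)) \<in> borel_measurable F"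
    by (rule measurable_comp[rotated])
  then show ?thesis by (simp add: comp_def)
qed

lemma borel_measurable_C1_comp:
  fixes f :: "'b::euclidean_space \<Rightarrow> 'c::euclidean_space"
  assumes "\<And>z. (f has_derivative blinfun_apply (D z)) (at z)" "Z \<in> borel_measurable F"
  shows "(\<lambda>\<omega>. f (Z \<omega>)) \<in> borel_measurable F"
proof -
  have "continuous_on UNIV f"
    using assms(1) by (meson has_derivative_continuous continuous_at_imp_continuous_on)
  then have "f \<in> borel_measurable borel" by (rule borel_measurable_continuous_onI)
  then show ?thesis using assms(2) by measurable
qed

text \<open>The ball about 0 of radius \<open>norm x + norm y\<close> is convex and contains both
  points. Asking for the bound only there lets one lemma serve globally bounded derivatives as well
  as derivatives of linear growth.\<close>

lemma mean_value_bound: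
  fixes f :: "'b::real_normed_vector \<Rightarrow> 'c::real_normed_vector"
  assumes "\<And>z. (f has_derivative blinfun_apply (D z)) (at z)"
    and "\<And>z. norm z \<le> norm x + norm y \<Longrightarrow> norm (D z) \<le> B"
  shows "norm (f x - f y) \<le> B * norm (x - y)"
proof (rule differentiable_bound[where S="cball 0 (norm x + norm y)" and f'="\<lambda>z. blinfun_apply (D z)"])
  show "onorm (blinfun_apply (D z)) \<le> B" if "z \<in> cball 0 (norm x + norm y)" for z
    using that assms(2) by (auto simp: norm_blinfun.rep_eq)
qed (use assms in \<open>auto intro: has_derivative_at_withinI\<close>)

lemma difference_quotient_tendsto:
  fixes f :: "'b::real_normed_vector \<Rightarrow> 'c::real_normed_vector"
  assumes "(f has_derivative D) (at z)" and "t \<longlonglongrightarrow> 0" and "\<And>j. t j > 0"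
  shows "(\<lambda>j. (1 / t j) *\<^sub>R (f (z + t j *\<^sub>R y) - f z)) \<longlonglongrightarrow> D y"
proof -
  have lin: "linear D" using assms(1) has_derivative_linear by blast
  have "((\<lambda>s. z + s *\<^sub>R y) has_derivative (\<lambda>s. s *\<^sub>R y)) (at 0)"
    by (auto intro!: derivative_eq_intros)
  moreover have "(f has_derivative D) (at (z + 0 *\<^sub>R y))" using assms(1) by simp
  ultimately have "((\<lambda>s. f (z + s *\<^sub>R y)) has_derivative (\<lambda>s. D (s *\<^sub>R y))) (at (0::real))"
    using has_derivative_compose by blast
  then have "((\<lambda>s. f (z + s *\<^sub>R y)) has_vector_derivative D y) (at (0::real))"
    using lin by (simp add: has_vector_derivative_def linear_scale)
  then have *: "((\<lambda>s. norm (f (z + s *\<^sub>R y) - f z - s *\<^sub>R D y) / norm s) \<longlongrightarrow> 0) (at (0::real))"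
    by (simp add: has_vector_derivative_def has_derivative_iff_norm)
  have "filterlim t (at 0) sequentially"
    using assms(2,3) by (auto simp: filterlim_at less_imp_neq[symmetric])
  from filterlim_compose[OF * this]
  have "(\<lambda>j. norm (f (z + t j *\<^sub>R y) - f z - t j *\<^sub>R D y) / norm (t j)) \<longlonglongrightarrow> 0" .
  moreover have "norm (f (z + t j *\<^sub>R y) - f z - t j *\<^sub>R D y) / norm (t j)
      = norm ((1 / t j) *\<^sub>R (f (z + t j *\<^sub>R y) - f z) - D y)" for j
  proof -
    have "(1 / t j) *\<^sub>R (f (z + t j *\<^sub>R y) - f z) - D y
       = (1 / t j) *\<^sub>R (f (z + t j *\<^sub>R y) - f z - t j *\<^sub>R D y)"
      using assms(3)[of j] by (simp add: scaleR_diff_right)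
    then show ?thesis using assms(3)[of j] by simp
  qed
  ultimately show ?thesis
    by (simp add: LIM_zero_cancel tendsto_norm_zero_iff)
qed

lemma L2_deriv_apply:
  fixes D :: "'b::euclidean_space \<Rightarrow> 'b \<Rightarrow>\<^sub>L 'c::euclidean_space"
  assumes F: "subalgebra M F" and D: "continuous_on UNIV D" "\<And>z. norm (D z) \<le> L"
    and Z: "Z \<in> borel_measurable F" and Y: "L2 M F Y"
  shows "L2 M F (\<lambda>\<omega>. blinfun_apply (D (Z \<omega>)) (Y \<omega>))"
proof (rule L2_bound[OF F])
  show "integrable M (\<lambda>\<omega>. (L * norm (Y \<omega>))\<^sup>2)"
    using Y by (auto simp: L2_def power_mult_distrib)
  show "norm (blinfun_apply (D (Z \<omega>)) (Y \<omega>)) \<le> L * norm (Y \<omega>)" for \<omega>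
    using norm_blinfun[of "D (Z \<omega>)" "Y \<omega>"] mult_right_mono[OF D(2) norm_ge_zero]
    by (rule order_trans)
qed (use Y in \<open>auto intro!: borel_measurable_deriv_apply D Z simp: L2_def\<close>)

text \<open>Comparison with the value at 0 turns the derivative bound into linear growth, and
  constants are square integrable on a finite measure space.\<close>

lemma L2_Lipschitz_comp:
  fixes f :: "'b::euclidean_space \<Rightarrow> 'c::euclidean_space"
  assumes "finite_measure M" and F: "subalgebra M F"
    and f: "\<And>z. (f has_derivative blinfun_apply (D z)) (at z)" "\<And>z. norm (D z) \<le> L"
    and Z: "L2 M F Z"
  shows "L2 M F (\<lambda>\<omega>. f (Z \<omega>))"
proof (rule L2_bound[OF F])
  have "L2 M F (\<lambda>\<omega>. norm (f 0) + L *\<^sub>R norm (Z \<omega>))"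
    by (intro L2_add[OF F] L2_const L2_scaleR L2_norm assms)
  then show "integrable M (\<lambda>\<omega>. (norm (f 0) + L * norm (Z \<omega>))\<^sup>2)"
    by (auto simp: L2_def)
  show "norm (f (Z \<omega>)) \<le> norm (f 0) + L * norm (Z \<omega>)" for \<omega>
    using mean_value_bound[OF f(1), of "Z \<omega>" 0 L] f(2) norm_triangle_sub[of "f (Z \<omega>)" "f 0"] by auto
qed (use Z in \<open>auto intro!: borel_measurable_C1_comp[OF f(1)] simp: L2_def\<close>)

text \<open>Differentiability of Nemytskii operators in the sense of Hadamard. The Lipschitz bound
  reduces moving directions \<open>Y j\<close> to the fixed direction \<open>Y'\<close>, for which dominated
  convergence applies.\<close>
lemma L2_tendsto_difference_quotient:
  fixes f :: "'b::euclidean_space \<Rightarrow> 'c::euclidean_space"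
  assumes "finite_measure M" and F: "subalgebra M F"
    and f: "\<And>z. (f has_derivative blinfun_apply (D z)) (at z)" "continuous_on UNIV D" "\<And>z. norm (D z) \<le> L"
    and Z: "L2 M F Z" and Y: "L2_tendsto M F Y Y'"
    and t: "t \<longlonglongrightarrow> 0" "\<And>j. t j > 0"
  shows "L2_tendsto M F (\<lambda>j \<omega>. (1 / t j) *\<^sub>R (f (Z \<omega> + t j *\<^sub>R Y j \<omega>) - f (Z \<omega>)))
           (\<lambda>\<omega>. blinfun_apply (D (Z \<omega>)) (Y' \<omega>))"
proof -
  let ?Q = "\<lambda>V j \<omega>. (1 / t j) *\<^sub>R (f (Z \<omega> + t j *\<^sub>R V \<omega>) - f (Z \<omega>))"
  have L2Y: "L2 M F Y'" "\<And>j. L2 M F (Y j)" using Y by (auto simp: L2_tendsto_def)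
  have L2Q: "L2 M F (?Q V j)" if "L2 M F V" for V j
    by (intro L2_scaleR L2_diff[OF F] L2_Lipschitz_comp[OF assms(1) F f(1,3)] L2_add[OF F] Z that)
  have L2D: "L2 M F (\<lambda>\<omega>. blinfun_apply (D (Z \<omega>)) (Y' \<omega>))"
    by (rule L2_deriv_apply[OF F f(2,3)]) (use Z L2Y in \<open>auto simp: L2_def\<close>)
  have lip: "norm (f x - f y) \<le> L * norm (x - y)" for x y
    by (rule mean_value_bound[OF f(1)]) (rule f(3))
  \<comment> \<open>The step length cancels, so the quotients are Lipschitz in the direction with
    the same constant for every \<open>j\<close>.\<close>
  have Qlip: "norm (?Q V j \<omega> - ?Q V' j \<omega>) \<le> L * norm (V \<omega> - V' \<omega>)" for V V' j \<omega>
  proof -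
    have "?Q V j \<omega> - ?Q V' j \<omega> = (1 / t j) *\<^sub>R (f (Z \<omega> + t j *\<^sub>R V \<omega>) - f (Z \<omega> + t j *\<^sub>R V' \<omega>))"
      by (simp add: algebra_simps)
    also have "norm \<dots> = (1 / t j) * norm (f (Z \<omega> + t j *\<^sub>R V \<omega>) - f (Z \<omega> + t j *\<^sub>R V' \<omega>))"
      using t(2)[of j] by simp
    also have "\<dots> \<le> (1 / t j) * (L * norm (t j *\<^sub>R (V \<omega> - V' \<omega>)))"
      using lip[of "Z \<omega> + t j *\<^sub>R V \<omega>" "Z \<omega> + t j *\<^sub>R V' \<omega>"] t(2)[of j]
      by (intro mult_left_mono) (auto simp: scaleR_diff_right)
    also have "\<dots> = L * norm (V \<omega> - V' \<omega>)" using t(2)[of j] by simp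
    finally show ?thesis .
  qed
  have 1: "L2_tendsto M F (\<lambda>j. ?Q Y' j) (\<lambda>\<omega>. blinfun_apply (D (Z \<omega>)) (Y' \<omega>))"
    unfolding L2_tendsto_def
  proof (intro conjI allI L2Q L2Y L2D)
    have "(\<lambda>j. \<integral>\<omega>. (norm (?Q Y' j \<omega> - blinfun_apply (D (Z \<omega>)) (Y' \<omega>)))\<^sup>2 \<partial>M) \<longlonglongrightarrow> (\<integral>\<omega>. 0 \<partial>M)"
    proof (rule integral_dominated_convergence)
      show "integrable M (\<lambda>\<omega>. (2 * L * norm (Y' \<omega>))\<^sup>2)"
        using L2Y by (auto simp: L2_def power_mult_distrib)
      show "AE \<omega> in M. (\<lambda>j. (norm (?Q Y' j \<omega> - blinfun_apply (D (Z \<omega>)) (Y' \<omega>)))\<^sup>2) \<longlonglongrightarrow> 0"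
      proof (rule AE_I2)
        fix \<omega>
        have "(\<lambda>j. (norm (?Q Y' j \<omega> - blinfun_apply (D (Z \<omega>)) (Y' \<omega>)))\<^sup>2)
            \<longlonglongrightarrow> (norm (blinfun_apply (D (Z \<omega>)) (Y' \<omega>) - blinfun_apply (D (Z \<omega>)) (Y' \<omega>)))\<^sup>2"
          by (intro tendsto_intros difference_quotient_tendsto f t)
        then show "(\<lambda>j. (norm (?Q Y' j \<omega> - blinfun_apply (D (Z \<omega>)) (Y' \<omega>)))\<^sup>2) \<longlonglongrightarrow> 0" by simp
      qed
      fix j
      show "AE \<omega> in M. norm ((norm (?Q Y' j \<omega> - blinfun_apply (D (Z \<omega>)) (Y' \<omega>)))\<^sup>2) \<le> (2 * L * norm (Y' \<omega>))\<^sup>2"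
      proof (rule AE_I2)
        fix \<omega>
        have "norm (?Q Y' j \<omega> - blinfun_apply (D (Z \<omega>)) (Y' \<omega>))
           \<le> norm (?Q Y' j \<omega>) + norm (blinfun_apply (D (Z \<omega>)) (Y' \<omega>))"
          by (rule norm_triangle_ineq4)
        also have "\<dots> \<le> L * norm (Y' \<omega>) + L * norm (Y' \<omega>)"
          \<comment> \<open>The quotient in direction 0 vanishes, so the Lipschitz estimate against
            it bounds the quotient itself by \<open>L * norm (Y' \<omega>)\<close>; the derivative
            contributes the second copy.\<close>
          using Qlip[where V=Y' and V'="\<lambda>_. 0" and j=j and \<omega>=\<omega>] norm_blinfun[of "D (Z \<omega>)" "Y' \<omega>"]
            mult_right_mono[OF f(3)[of "Z \<omega>"] norm_ge_zero[of "Y' \<omega>"]] by auto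
        finally have "norm (?Q Y' j \<omega> - blinfun_apply (D (Z \<omega>)) (Y' \<omega>)) \<le> 2 * L * norm (Y' \<omega>)"
          by simp
        then show "norm ((norm (?Q Y' j \<omega> - blinfun_apply (D (Z \<omega>)) (Y' \<omega>)))\<^sup>2) \<le> (2 * L * norm (Y' \<omega>))\<^sup>2"
          by (simp add: power_mono)
      qed
      show "(\<lambda>\<omega>. (norm (?Q Y' j \<omega> - blinfun_apply (D (Z \<omega>)) (Y' \<omega>)))\<^sup>2) \<in> borel_measurable M"
        using L2_subalgebra[OF F L2_diff[OF F L2Q[OF L2Y(1)] L2D]] by (auto simp: L2_def)
    qed auto
    then show "(\<lambda>j. \<integral>\<omega>. (norm (?Q Y' j \<omega> - blinfun_apply (D (Z \<omega>)) (Y' \<omega>)))\<^sup>2 \<partial>M) \<longlonglongrightarrow> 0"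
      by simp
  qed
  have 2: "L2_tendsto M F (\<lambda>j \<omega>. ?Q (Y j) j \<omega> - ?Q Y' j \<omega>) (\<lambda>\<omega>. 0)"
  proof (rule L2_tendsto_dominated)
    have "(\<lambda>j. L\<^sup>2 * (\<integral>\<omega>. (norm (Y j \<omega> - Y' \<omega>))\<^sup>2 \<partial>M)) \<longlonglongrightarrow> L\<^sup>2 * 0"
      using Y by (intro tendsto_intros) (auto simp: L2_tendsto_def)
    then show "(\<lambda>j. L\<^sup>2 * (\<integral>\<omega>. (norm (Y j \<omega> - Y' \<omega>))\<^sup>2 \<partial>M)) \<longlonglongrightarrow> 0" by simp
    fix j
    show dif: "L2 M F (\<lambda>\<omega>. ?Q (Y j) j \<omega> - ?Q Y' j \<omega>)"
      by (intro L2_diff[OF F] L2Q L2Y)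
    have "(\<integral>\<omega>. (norm (?Q (Y j) j \<omega> - ?Q Y' j \<omega>))\<^sup>2 \<partial>M) \<le> (\<integral>\<omega>. L\<^sup>2 * (norm (Y j \<omega> - Y' \<omega>))\<^sup>2 \<partial>M)"
    proof (rule integral_mono)
      show "integrable M (\<lambda>\<omega>. (norm (?Q (Y j) j \<omega> - ?Q Y' j \<omega>))\<^sup>2)" using dif by (simp add: L2_def)
      show "integrable M (\<lambda>\<omega>. L\<^sup>2 * (norm (Y j \<omega> - Y' \<omega>))\<^sup>2)"
        using L2_diff[OF F L2Y(2) L2Y(1)] by (auto simp: L2_def)
      show "(norm (?Q (Y j) j \<omega> - ?Q Y' j \<omega>))\<^sup>2 \<le> L\<^sup>2 * (norm (Y j \<omega> - Y' \<omega>))\<^sup>2" for \<omega>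
        using power_mono[OF Qlip[where V="Y j" and V'=Y' and j=j and \<omega>=\<omega>] norm_ge_zero, of 2] by (simp add: power_mult_distrib)
    qed
    then show "(\<integral>\<omega>. (norm (?Q (Y j) j \<omega> - ?Q Y' j \<omega> - 0))\<^sup>2 \<partial>M) \<le> L\<^sup>2 * (\<integral>\<omega>. (norm (Y j \<omega> - Y' \<omega>))\<^sup>2 \<partial>M)"
      by simp
  qed (simp add: L2_def)
  show ?thesis using L2_tendsto_add[OF F 2 1] by simp
qed

section \<open>Functionals of quadratic growth\<close>

lemma integrable_quadratic_growth:
  fixes f :: "'b::euclidean_space \<Rightarrow> real"
  assumes "finite_measure M"
    and f: "\<And>z. (f has_derivative blinfun_apply (D z)) (at z)" "\<And>z. norm (D z) \<le> c * (1 + norm z)"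
    and c: "c \<ge> 0" and Z: "L2 M M Z"
  shows "integrable M (\<lambda>\<omega>. f (Z \<omega>))"
proof (rule Bochner_Integration.integrable_bound)
  let ?g = "\<lambda>\<omega>. \<bar>f 0\<bar> + c * (norm (1 + norm (Z \<omega>)) * norm (Z \<omega>))"
  show "integrable M ?g"
    by (intro Bochner_Integration.integrable_add integrable_mult_right integrable_norm_mult
          L2_add[OF subalgebra_refl] L2_const L2_norm Z finite_measure.integrable_const assms(1))
  show "AE \<omega> in M. norm (f (Z \<omega>)) \<le> norm (?g \<omega>)"
  proof (rule AE_I2)
    fix \<omega>
    have "norm (f (Z \<omega>) - f 0) \<le> c * (1 + norm (Z \<omega>)) * norm (Z \<omega> - 0)"
    proof (rule mean_value_bound[OF f(1)])
      fix z :: 'b assume "norm z \<le> norm (Z \<omega>) + norm (0::'b)"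
      then have "c * (1 + norm z) \<le> c * (1 + norm (Z \<omega>))" using c by (intro mult_left_mono) auto
      then show "norm (D z) \<le> c * (1 + norm (Z \<omega>))" using f(2)[of z] by linarith
    qed
    then show "norm (f (Z \<omega>)) \<le> norm (?g \<omega>)" by (auto simp: mult.assoc)
  qed
qed (use Z in \<open>auto intro!: borel_measurable_C1_comp[OF f(1)] simp: L2_def\<close>)

text \<open>Here the operator norm grows with \<open>Z\<close>, so the value is dominated by a
  product of two \<open>L2\<close> functions: it is integrable, but not in \<open>L2\<close> as for
  bounded derivatives.\<close>

lemma integrable_deriv_apply:
  fixes D :: "'b::euclidean_space \<Rightarrow> 'b \<Rightarrow>\<^sub>L real"
  assumes "finite_measure M" and D: "continuous_on UNIV D" "\<And>z. norm (D z) \<le> c * (1 + norm z)"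
    and Z: "L2 M M Z" and Y: "L2 M M Y"
  shows "integrable M (\<lambda>\<omega>. blinfun_apply (D (Z \<omega>)) (Y \<omega>))"
proof (rule Bochner_Integration.integrable_bound)
  let ?g = "\<lambda>\<omega>. c * (norm (1 + norm (Z \<omega>)) * norm (Y \<omega>))"
  show "integrable M ?g"
    by (intro integrable_mult_right integrable_norm_mult L2_add[OF subalgebra_refl]
          L2_const L2_norm Z Y assms(1))
  show "AE \<omega> in M. norm (blinfun_apply (D (Z \<omega>)) (Y \<omega>)) \<le> norm (?g \<omega>)"
  proof (rule AE_I2)
    fix \<omega>
    have "norm (blinfun_apply (D (Z \<omega>)) (Y \<omega>)) \<le> c * (1 + norm (Z \<omega>)) * norm (Y \<omega>)"
      using norm_blinfun[of "D (Z \<omega>)" "Y \<omega>"] mult_right_mono[OF D(2) norm_ge_zero]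
      by (rule order_trans)
    then show "norm (blinfun_apply (D (Z \<omega>)) (Y \<omega>)) \<le> norm (?g \<omega>)" by (auto simp: mult.assoc)
  qed
  show "(\<lambda>\<omega>. blinfun_apply (D (Z \<omega>)) (Y \<omega>)) \<in> borel_measurable M"
    by (rule borel_measurable_deriv_apply[OF D(1)]) (use Z Y in \<open>auto simp: L2_def\<close>)
qed

lemma L2_tendsto_bounded:
  assumes F: "subalgebra M F" and Y: "L2_tendsto M F Y Y'"
  obtains B where "\<And>j. (\<integral>\<omega>. (norm (Y j \<omega>))\<^sup>2 \<partial>M) \<le> B"
proof -
  have "Bseq (\<lambda>j. \<integral>\<omega>. (norm (Y j \<omega> - Y' \<omega>))\<^sup>2 \<partial>M)"
    using Y by (intro convergent_imp_Bseq convergentI[of _ 0]) (simp add: L2_tendsto_def)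
  then obtain B where B: "\<And>j. norm (\<integral>\<omega>. (norm (Y j \<omega> - Y' \<omega>))\<^sup>2 \<partial>M) \<le> B"
    unfolding Bseq_def by blast
  have "(\<integral>\<omega>. (norm (Y j \<omega>))\<^sup>2 \<partial>M) \<le> 2 * B + 2 * (\<integral>\<omega>. (norm (Y' \<omega>))\<^sup>2 \<partial>M)" for j
  proof -
    have "L2 M M (\<lambda>\<omega>. Y j \<omega> - Y' \<omega>)" "L2 M M Y'"
      using Y by (auto simp: L2_tendsto_def intro!: L2_subalgebra[OF F] L2_diff[OF F])
    from integral_norm_add_sq_le[OF this]
    have "(\<integral>\<omega>. (norm (Y j \<omega>))\<^sup>2 \<partial>M)
      \<le> 2 * (\<integral>\<omega>. (norm (Y j \<omega> - Y' \<omega>))\<^sup>2 \<partial>M) + 2 * (\<integral>\<omega>. (norm (Y' \<omega>))\<^sup>2 \<partial>M)"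
      by simp
    moreover have "(\<integral>\<omega>. (norm (Y j \<omega> - Y' \<omega>))\<^sup>2 \<partial>M) \<le> B" using B[of j] by simp
    ultimately show ?thesis by linarith
  qed
  then show thesis by (rule that)
qed

text \<open>A weighted Young inequality replaces Cauchy-Schwarz: a small weight on the bounded
  factor costs a large weight on the other one, which its convergence to 0 absorbs.\<close>

lemma integral_product_tendsto_0:
  fixes f g :: "nat \<Rightarrow> 'a \<Rightarrow> real"
  assumes f: "\<And>j. L2 M M (f j)" "\<And>j. (\<integral>\<omega>. (norm (f j \<omega>))\<^sup>2 \<partial>M) \<le> B"
    and g: "\<And>j. L2 M M (g j)" "(\<lambda>j. \<integral>\<omega>. (norm (g j \<omega>))\<^sup>2 \<partial>M) \<longlonglongrightarrow> 0"
  shows "(\<lambda>j. \<integral>\<omega>. norm (f j \<omega>) * norm (g j \<omega>) \<partial>M) \<longlonglongrightarrow> 0"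
proof (rule LIMSEQ_I)
  fix r :: real assume r: "r > 0"
  have B: "B \<ge> 0" using order_trans[OF _ f(2)[of 0]] by simp
  \<comment> \<open>The \<open>+ 1\<close> keeps the denominator positive when \<open>B = 0\<close>
    and makes \<open>e * B < r\<close> strict. The threshold \<open>e * r\<close> for the second
    factor is chosen so that its weight \<open>1 / (2 * e)\<close> leaves exactly
    \<open>r / 2\<close>.\<close>
  define e where "e = r / (B + 1)"
  have e: "e > 0" "e * B < r" using r B by (auto simp: e_def field_simps)
  obtain n where n: "\<And>j. j \<ge> n \<Longrightarrow> (\<integral>\<omega>. (norm (g j \<omega>))\<^sup>2 \<partial>M) < e * r"
    using LIMSEQ_D[OF g(2), of "e * r"] e r by auto
  have "norm ((\<integral>\<omega>. norm (f j \<omega>) * norm (g j \<omega>) \<partial>M) - 0) < r" if j: "j \<ge> n" for j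
  proof -
    have young: "x * y \<le> (e / 2) * x\<^sup>2 + (1 / (2 * e)) * y\<^sup>2" for x y :: real
    proof -
      have "0 \<le> (e * x - y)\<^sup>2 / (2 * e)" using e by simp
      also have "\<dots> = (e / 2) * x\<^sup>2 + (1 / (2 * e)) * y\<^sup>2 - x * y"
        using e by (simp add: power2_diff field_simps power2_eq_square)
      finally show ?thesis by simp
    qed
    have "(\<integral>\<omega>. norm (f j \<omega>) * norm (g j \<omega>) \<partial>M)
        \<le> (\<integral>\<omega>. (e / 2) * (norm (f j \<omega>))\<^sup>2 + (1 / (2 * e)) * (norm (g j \<omega>))\<^sup>2 \<partial>M)"
      by (intro integral_mono young integrable_norm_mult f(1) g(1) Bochner_Integration.integrable_add
            integrable_mult_right L2_integrable[OF f(1)] L2_integrable[OF g(1)])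
    also have "\<dots> = (e / 2) * (\<integral>\<omega>. (norm (f j \<omega>))\<^sup>2 \<partial>M) + (1 / (2 * e)) * (\<integral>\<omega>. (norm (g j \<omega>))\<^sup>2 \<partial>M)"
      using L2_integrable[OF f(1)[of j]] L2_integrable[OF g(1)[of j]]
      by (subst Bochner_Integration.integral_add) auto
    also have "\<dots> \<le> (e / 2) * B + (1 / (2 * e)) * (\<integral>\<omega>. (norm (g j \<omega>))\<^sup>2 \<partial>M)"
      using f(2)[of j] e by (intro add_mono mult_left_mono) auto
    also have "\<dots> < r / 2 + (1 / (2 * e)) * (e * r)"
      using n[OF j] e by (intro add_less_le_mono mult_left_mono) auto
    also have "\<dots> = r" using e by simp
    finally show ?thesis
      by (simp add: Bochner_Integration.integral_nonneg)
  qed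
  then show "\<exists>no. \<forall>n\<ge>no. norm ((\<integral>\<omega>. norm (f n \<omega>) * norm (g n \<omega>) \<partial>M) - 0) < r" by blast
qed

text \<open>As for Lipschitz maps, the moving direction is compared with its limit, but the
  Lipschitz factor is now a function that is only square integrable. The comparison error is
  therefore controlled through \<open>integral_product_tendsto_0\<close>.\<close>

lemma integral_difference_quotient_tendsto:
  fixes f :: "'b::euclidean_space \<Rightarrow> real"
  assumes fin: "finite_measure M"
    and f: "\<And>z. (f has_derivative blinfun_apply (D z)) (at z)" "continuous_on UNIV D"
      "\<And>z. norm (D z) \<le> c * (1 + norm z)" and c: "c \<ge> 0"
    and Z: "L2 M M Z" and Y: "L2_tendsto M M Y Y'"
    and t: "t \<longlonglongrightarrow> 0" "\<And>j. t j > 0" "\<And>j. t j \<le> 1"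
  shows "(\<lambda>j. \<integral>\<omega>. (1 / t j) * (f (Z \<omega> + t j *\<^sub>R Y j \<omega>) - f (Z \<omega>)) \<partial>M)
           \<longlonglongrightarrow> (\<integral>\<omega>. blinfun_apply (D (Z \<omega>)) (Y' \<omega>) \<partial>M)"
proof -
  let ?Q = "\<lambda>V j \<omega>. (1 / t j) * (f (Z \<omega> + t j *\<^sub>R V \<omega>) - f (Z \<omega>))"
  \<comment> \<open>For \<open>t j \<le> 1\<close> both endpoints have norm at most
    \<open>norm (Z \<omega>)\<close> plus that of their direction; the sum of these two bounds is
    the radius on which the derivative must be estimated, hence the factor 2.\<close>
  let ?K = "\<lambda>(V::'a \<Rightarrow> 'b) (V'::'a \<Rightarrow> 'b) \<omega>. c * (1 + 2 * norm (Z \<omega>) + norm (V \<omega>) + norm (V' \<omega>))"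
  note R = subalgebra_refl[of M]
  have L2Y: "L2 M M Y'" "\<And>j. L2 M M (Y j)" using Y by (auto simp: L2_tendsto_def)
  have intQ: "integrable M (?Q V j)" if "L2 M M V" for V j
    by (intro integrable_mult_right Bochner_Integration.integrable_diff
         integrable_quadratic_growth[OF fin f(1,3) c] L2_add[OF R] L2_scaleR Z that)
  have Qlip: "\<bar>?Q V j \<omega> - ?Q V' j \<omega>\<bar> \<le> ?K V V' \<omega> * norm (V \<omega> - V' \<omega>)" for V V' j \<omega>
  proof -
    have "norm (f (Z \<omega> + t j *\<^sub>R V \<omega>) - f (Z \<omega> + t j *\<^sub>R V' \<omega>))
        \<le> ?K V V' \<omega> * norm ((Z \<omega> + t j *\<^sub>R V \<omega>) - (Z \<omega> + t j *\<^sub>R V' \<omega>))"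
    proof (rule mean_value_bound[OF f(1)])
      fix z :: 'b assume z: "norm z \<le> norm (Z \<omega> + t j *\<^sub>R V \<omega>) + norm (Z \<omega> + t j *\<^sub>R V' \<omega>)"
      have *: "norm (Z \<omega> + t j *\<^sub>R W) \<le> norm (Z \<omega>) + norm W" for W
      proof -
        have "norm (t j *\<^sub>R W) \<le> norm W"
          using t(2,3)[of j] by (simp add: mult_left_le_one_le)
        then show ?thesis using norm_triangle_ineq[of "Z \<omega>" "t j *\<^sub>R W"] by linarith
      qed
      have le: "1 + norm z \<le> 1 + 2 * norm (Z \<omega>) + norm (V \<omega>) + norm (V' \<omega>)"
        using z *[of "V \<omega>"] *[of "V' \<omega>"] by linarith
      show "norm (D z) \<le> ?K V V' \<omega>"
        by (rule order_trans[OF f(3) mult_left_mono[OF le c]])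
    qed
    then have le: "\<bar>f (Z \<omega> + t j *\<^sub>R V \<omega>) - f (Z \<omega> + t j *\<^sub>R V' \<omega>)\<bar> \<le> ?K V V' \<omega> * (t j * norm (V \<omega> - V' \<omega>))"
      using t(2)[of j] by (simp add: scaleR_diff_right[symmetric])
    have "?Q V j \<omega> - ?Q V' j \<omega> = (1 / t j) * (f (Z \<omega> + t j *\<^sub>R V \<omega>) - f (Z \<omega> + t j *\<^sub>R V' \<omega>))"
      by (simp add: algebra_simps)
    also have "\<bar>\<dots>\<bar> = (1 / t j) * \<bar>f (Z \<omega> + t j *\<^sub>R V \<omega>) - f (Z \<omega> + t j *\<^sub>R V' \<omega>)\<bar>"
      using t(2)[of j] by (simp add: abs_mult)
    also have "\<dots> \<le> (1 / t j) * (?K V V' \<omega> * (t j * norm (V \<omega> - V' \<omega>)))"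
      using le t(2)[of j] by (intro mult_left_mono) auto
    also have "\<dots> = ?K V V' \<omega> * norm (V \<omega> - V' \<omega>)" using t(2)[of j] by simp
    finally show ?thesis .
  qed
  have L2K: "L2 M M (?K V V')" if "L2 M M V" "L2 M M V'" for V V'
  proof -
    have "L2 M M (\<lambda>\<omega>. c *\<^sub>R (1 + 2 *\<^sub>R norm (Z \<omega>) + norm (V \<omega>) + norm (V' \<omega>)))"
      by (intro L2_scaleR L2_add[OF R] L2_const L2_norm Z that fin)
    then show ?thesis by simp
  qed
  have absK: "\<bar>c * (1 + 2 * norm z + norm v + norm v')\<bar> = c * (1 + 2 * norm z + norm v + norm v')"
    for z v v' :: 'b using c by simp
  have intK: "integrable M (\<lambda>\<omega>. ?K V V' \<omega> * norm (V \<omega> - V' \<omega>))" if "L2 M M V" "L2 M M V'" for V V'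
    using integrable_norm_mult[OF L2K[OF that] L2_norm[OF L2_diff[OF R that]]]
    by (simp only: absK real_norm_def abs_norm_cancel)
  have 1: "(\<lambda>j. \<integral>\<omega>. ?Q Y' j \<omega> \<partial>M) \<longlonglongrightarrow> (\<integral>\<omega>. blinfun_apply (D (Z \<omega>)) (Y' \<omega>) \<partial>M)"
  \<comment> \<open>Comparing the fixed direction \<open>Y'\<close> with direction 0, whose quotient
    vanishes, provides the dominating function.\<close>
  proof (rule integral_dominated_convergence[where w="\<lambda>\<omega>. ?K Y' (\<lambda>_. 0) \<omega> * norm (Y' \<omega> - 0)"])
    show "integrable M (\<lambda>\<omega>. ?K Y' (\<lambda>_. 0) \<omega> * norm (Y' \<omega> - 0))"
      by (rule intK) (use L2Y in \<open>auto simp: L2_def\<close>)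
    show "(\<lambda>\<omega>. blinfun_apply (D (Z \<omega>)) (Y' \<omega>)) \<in> borel_measurable M"
      by (rule borel_measurable_integrable[OF integrable_deriv_apply[OF fin f(2,3) Z L2Y(1)]])
    show "?Q Y' j \<in> borel_measurable M" for j by (rule borel_measurable_integrable[OF intQ[OF L2Y(1)]])
    show "AE \<omega> in M. (\<lambda>j. ?Q Y' j \<omega>) \<longlonglongrightarrow> blinfun_apply (D (Z \<omega>)) (Y' \<omega>)"
      using difference_quotient_tendsto[OF f(1) t(1,2)] by (intro AE_I2) simp
    show "AE \<omega> in M. norm (?Q Y' j \<omega>) \<le> ?K Y' (\<lambda>_. 0) \<omega> * norm (Y' \<omega> - 0)" for j
      using Qlip[where V=Y' and V'="\<lambda>_. 0" and j=j] by (intro AE_I2) (simp only: scaleR_zero_right add_0_right diff_self mult_zero_right diff_0_right real_norm_def)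
  qed
  have 2: "(\<lambda>j. (\<integral>\<omega>. ?Q (Y j) j \<omega> \<partial>M) - (\<integral>\<omega>. ?Q Y' j \<omega> \<partial>M)) \<longlonglongrightarrow> 0"
  proof (rule tendsto_rabs_zero_cancel, rule tendsto_sandwich[OF _ _ tendsto_const])
    obtain B1 where B1: "\<And>j. (\<integral>\<omega>. (norm (Y j \<omega>))\<^sup>2 \<partial>M) \<le> B1"
      using L2_tendsto_bounded[OF R Y] by blast
    \<comment> \<open>\<open>W\<close> collects the part of the Lipschitz factor that does not
      depend on \<open>j\<close>; only \<open>c * norm (Y j \<omega>)\<close> remains, and
      convergence bounds it uniformly in \<open>L2\<close>.\<close>
    define W where "W \<omega> = c * (1 + 2 * norm (Z \<omega>) + norm (Y' \<omega>))" for \<omega>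
    have "L2 M M (\<lambda>\<omega>. c *\<^sub>R (1 + 2 *\<^sub>R norm (Z \<omega>) + norm (Y' \<omega>)))"
      by (intro L2_scaleR L2_add[OF R] L2_const L2_norm Z L2Y(1) fin)
    then have W: "L2 M M W" by (simp add: W_def[abs_def])
    have KW: "?K (Y j) Y' \<omega> = W \<omega> + c *\<^sub>R norm (Y j \<omega>)" for j \<omega> by (simp add: W_def algebra_simps)
    have B: "(\<integral>\<omega>. (norm (?K (Y j) Y' \<omega>))\<^sup>2 \<partial>M) \<le> 2 * (\<integral>\<omega>. (norm (W \<omega>))\<^sup>2 \<partial>M) + 2 * (c\<^sup>2 * B1)" for j
    proof -
      have "(\<integral>\<omega>. (norm (?K (Y j) Y' \<omega>))\<^sup>2 \<partial>M)
         \<le> 2 * (\<integral>\<omega>. (norm (W \<omega>))\<^sup>2 \<partial>M) + 2 * (\<integral>\<omega>. (norm (c *\<^sub>R norm (Y j \<omega>)))\<^sup>2 \<partial>M)"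
        unfolding KW by (rule integral_norm_add_sq_le[OF W L2_scaleR[OF L2_norm[OF L2Y(2)]]])
      moreover have "(\<integral>\<omega>. (norm (c *\<^sub>R norm (Y j \<omega>)))\<^sup>2 \<partial>M) = c\<^sup>2 * (\<integral>\<omega>. (norm (Y j \<omega>))\<^sup>2 \<partial>M)"
        by (simp add: power_mult_distrib)
      moreover have "\<dots> \<le> c\<^sup>2 * B1" using B1[of j] by (simp add: mult_left_mono)
      ultimately show ?thesis by linarith
    qed
    have "(\<lambda>j. \<integral>\<omega>. norm (?K (Y j) Y' \<omega>) * norm (norm (Y j \<omega> - Y' \<omega>)) \<partial>M) \<longlonglongrightarrow> 0"
      by (rule integral_product_tendsto_0[OF L2K[OF L2Y(2,1)] B L2_norm[OF L2_diff[OF R L2Y(2,1)]]])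
        (use Y in \<open>simp add: L2_tendsto_def\<close>)
    then show "(\<lambda>j. \<integral>\<omega>. ?K (Y j) Y' \<omega> * norm (Y j \<omega> - Y' \<omega>) \<partial>M) \<longlonglongrightarrow> 0"
      by (simp only: absK real_norm_def abs_norm_cancel)
    have "\<bar>(\<integral>\<omega>. ?Q (Y j) j \<omega> \<partial>M) - (\<integral>\<omega>. ?Q Y' j \<omega> \<partial>M)\<bar> \<le> (\<integral>\<omega>. ?K (Y j) Y' \<omega> * norm (Y j \<omega> - Y' \<omega>) \<partial>M)" for j
    proof -
      note Q = intQ[OF L2Y(2)[of j], where j=j] intQ[OF L2Y(1), where j=j]
      have eq: "(\<integral>\<omega>. ?Q (Y j) j \<omega> \<partial>M) - (\<integral>\<omega>. ?Q Y' j \<omega> \<partial>M) = (\<integral>\<omega>. ?Q (Y j) j \<omega> - ?Q Y' j \<omega> \<partial>M)"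
        using Q by (rule Bochner_Integration.integral_diff[symmetric])
      have "\<bar>\<integral>\<omega>. ?Q (Y j) j \<omega> - ?Q Y' j \<omega> \<partial>M\<bar> \<le> (\<integral>\<omega>. \<bar>?Q (Y j) j \<omega> - ?Q Y' j \<omega>\<bar> \<partial>M)"
        by (rule integral_abs_bound)
      also have "\<dots> \<le> (\<integral>\<omega>. ?K (Y j) Y' \<omega> * norm (Y j \<omega> - Y' \<omega>) \<partial>M)"
      proof (rule integral_mono)
        show "integrable M (\<lambda>\<omega>. \<bar>?Q (Y j) j \<omega> - ?Q Y' j \<omega>\<bar>)"
          using Bochner_Integration.integrable_diff[OF Q] by (rule integrable_abs)
        show "integrable M (\<lambda>\<omega>. ?K (Y j) Y' \<omega> * norm (Y j \<omega> - Y' \<omega>))"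
          by (rule intK[where V="Y j" and V'=Y', OF L2Y(2,1)])
        show "\<bar>?Q (Y j) j \<omega> - ?Q Y' j \<omega>\<bar> \<le> ?K (Y j) Y' \<omega> * norm (Y j \<omega> - Y' \<omega>)" for \<omega>
          by (rule Qlip[where V="Y j" and V'=Y' and j=j and \<omega>=\<omega>])
      qed
      finally show ?thesis unfolding eq .
    qed
    then show "\<forall>\<^sub>F j in sequentially. \<bar>(\<integral>\<omega>. ?Q (Y j) j \<omega> \<partial>M) - (\<integral>\<omega>. ?Q Y' j \<omega> \<partial>M)\<bar>
        \<le> (\<integral>\<omega>. ?K (Y j) Y' \<omega> * norm (Y j \<omega> - Y' \<omega>) \<partial>M)" by simp
  qed simp
  show ?thesis using tendsto_add[OF 2 1] by simp
qed

section \<open>Filtration and conditional expectation\<close>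

lemma space_filt: "space (filt M w k) = space M"
  unfolding filt_def by (rule space_measure_of) auto

text \<open>Writing the generators as a union over time indices gives the form in which independent
  families can be grouped into blocks.\<close>

lemma sets_filt:
  "sets (filt M w k) = sigma_sets (space M) (\<Union>j\<in>{1..k}. {w j -` A \<inter> space M | A. A \<in> sets borel})"
proof -
  have "{w j -` A \<inter> space M | j A. j \<in> {1..k} \<and> A \<in> sets borel}
      = (\<Union>j\<in>{1..k}. {w j -` A \<inter> space M | A. A \<in> sets borel})" by blast
  then show ?thesis unfolding filt_def by (subst sets_measure_of) auto
qed

lemma subalgebra_filt:
  assumes "\<And>j. j \<in> {1..k} \<Longrightarrow> w j \<in> borel_measurable M"
  shows "subalgebra M (filt M w k)"
  unfolding subalgebra_def space_filt sets_filt
  using assms by (auto intro!: sets.sigma_sets_subset measurable_sets)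

lemma subalgebra_filt_mono: "j \<le> k \<Longrightarrow> subalgebra (filt M w k) (filt M w j)"
  unfolding subalgebra_def space_filt sets_filt
  by (intro conjI refl sigma_sets_mono' UN_mono) auto

lemma measurable_filt: "j \<in> {1..k} \<Longrightarrow> w j \<in> borel_measurable (filt M w k)"
  by (rule measurableI) (simp_all only: space_filt sets_filt space_borel UNIV_I, blast intro: sigma_sets.Basic)

text \<open>The times are split into the blocks \<open>{1..k}\<close> and \<open>{Suc k}\<close>.
  The generating families are stable under intersection, so the sigma algebras of disjoint blocks
  are independent, and independence passes to the smaller ones generated by \<open>g\<close> and by
  \<open>h\<close> of the next noise.\<close>

lemma (in prob_space) indep_var_filt:
  fixes g :: "'a \<Rightarrow> real" and h :: "real^'d::finite \<Rightarrow> real"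
  assumes indep: "indep_vars (\<lambda>_. borel) w {1..N}" and k: "Suc k \<le> N"
    and g: "g \<in> borel_measurable (filt M w k)" and h: "h \<in> borel_measurable borel"
  shows "indep_var borel g borel (\<lambda>\<omega>. h (w (Suc k) \<omega>))"
proof -
  let ?E = "\<lambda>i. {w i -` A \<inter> space M | A. A \<in> sets borel}"
  let ?I = "case_bool {1..k} {Suc k}"
  have rv: "\<And>j. j \<in> {1..N} \<Longrightarrow> w j \<in> borel_measurable M"
    and E: "indep_sets ?E {1..N}"
    using indep by (auto simp: indep_vars_def2)
  have sub: "subalgebra M (filt M w k)" using rv k by (intro subalgebra_filt) auto
  have hw: "(\<lambda>\<omega>. h (w (Suc k) \<omega>)) \<in> borel_measurable M"
    using measurable_compose[OF rv h, of "Suc k"] k by auto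
  have "indep_sets (\<lambda>j. sigma_sets (space M) (\<Union>i\<in>?I j. ?E i)) UNIV"
  proof (rule indep_sets_collect_sigma)
    show "indep_sets ?E (\<Union>j\<in>UNIV. ?I j)"
      by (rule indep_sets_mono_index[OF _ E]) (use k in \<open>auto split: bool.splits\<close>)
    show "disjoint_family_on ?I UNIV"
      by (auto simp: disjoint_family_on_def split: bool.splits)
    show "Int_stable (?E i)" for i
    proof (rule Int_stableI)
      fix a b assume "a \<in> ?E i" "b \<in> ?E i"
      then obtain A B where "A \<in> sets borel" "B \<in> sets borel"
        "a = w i -` A \<inter> space M" "b = w i -` B \<inter> space M" by blast
      then have "a \<inter> b = w i -` (A \<inter> B) \<inter> space M" "A \<inter> B \<in> sets borel" by auto
      then show "a \<inter> b \<in> ?E i" by blast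
    qed
  qed
  then have "indep_sets (case_bool (sigma_sets (space M) {g -` A \<inter> space M | A. A \<in> sets borel})
      (sigma_sets (space M) {(\<lambda>\<omega>. h (w (Suc k) \<omega>)) -` A \<inter> space M | A. A \<in> sets borel})) UNIV"
  proof (rule indep_sets_mono_sets)
    have 1: "sigma_sets (space M) {g -` A \<inter> space M | A. A \<in> sets borel}
       \<subseteq> sigma_sets (space M) (\<Union>i\<in>{1..k}. ?E i)"
      using measurable_sets[OF g] unfolding space_filt sets_filt
      by (intro sigma_sets_mono) auto
    have 2: "sigma_sets (space M) {(\<lambda>\<omega>. h (w (Suc k) \<omega>)) -` A \<inter> space M | A. A \<in> sets borel}
       \<subseteq> sigma_sets (space M) (?E (Suc k))"
    proof (rule sigma_sets_mono', safe)
      fix A :: "real set" assume "A \<in> sets borel"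
      then have "h -` A \<in> sets borel" using measurable_sets[OF h] by simp
      then show "\<exists>B. (\<lambda>\<omega>. h (w (Suc k) \<omega>)) -` A \<inter> space M = w (Suc k) -` B \<inter> space M \<and> B \<in> sets borel"
        by (intro exI[of _ "h -` A"]) auto
    qed
    show "case_bool (sigma_sets (space M) {g -` A \<inter> space M | A. A \<in> sets borel})
      (sigma_sets (space M) {(\<lambda>\<omega>. h (w (Suc k) \<omega>)) -` A \<inter> space M | A. A \<in> sets borel}) j
      \<subseteq> sigma_sets (space M) (\<Union>i\<in>?I j. ?E i)" for j
      using 1 2 by (cases j) auto
  qed
  then show ?thesis
    using measurable_subalgebra[OF sub g] hw by (simp add: indep_var_eq indep_set_def)
qed

text \<open>The squared norm of the product is \<open>(norm (g \<omega>))\<^sup>2\<close> times a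
  squared noise coordinate. These are independent and integrable, so the product is integrable and
  its expectation factors, the second factor being 1. Treating one coordinate at a time avoids cross
  terms.\<close>

lemma (in prob_space) noise_isometry:
  fixes g :: "'a \<Rightarrow> 'b::euclidean_space" and w :: "nat \<Rightarrow> 'a \<Rightarrow> real^'d::finite"
  assumes indep: "indep_vars (\<lambda>_. borel) w {1..N}" and k: "Suc k \<le> N"
    and var: "integrable M (\<lambda>\<omega>. (w (Suc k) \<omega> $ i)\<^sup>2)" "(\<integral>\<omega>. (w (Suc k) \<omega> $ i)\<^sup>2 \<partial>M) = 1"
    and g: "L2 M (filt M w k) g"
  shows "L2 M (filt M w (Suc k)) (\<lambda>\<omega>. (w (Suc k) \<omega> $ i) *\<^sub>R g \<omega>)"
    and "(\<integral>\<omega>. (norm ((w (Suc k) \<omega> $ i) *\<^sub>R g \<omega>))\<^sup>2 \<partial>M) = (\<integral>\<omega>. (norm (g \<omega>))\<^sup>2 \<partial>M)"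
proof -
  have ind: "indep_var borel (\<lambda>\<omega>. (norm (g \<omega>))\<^sup>2) borel (\<lambda>\<omega>. (\<lambda>x. (x $ i)\<^sup>2) (w (Suc k) \<omega>))"
    by (rule indep_var_filt[OF indep k]) (use g in \<open>auto simp: L2_def\<close>)
  have eq: "(norm ((w (Suc k) \<omega> $ i) *\<^sub>R g \<omega>))\<^sup>2 = (norm (g \<omega>))\<^sup>2 * (w (Suc k) \<omega> $ i)\<^sup>2" for \<omega>
    by (simp add: power_mult_distrib)
  have [measurable]: "g \<in> borel_measurable (filt M w (Suc k))"
    by (rule measurable_subalgebra[OF subalgebra_filt_mono[of k] L2_measurable[OF g]]) simp
  have [measurable]: "w (Suc k) \<in> borel_measurable (filt M w (Suc k))"
    by (rule measurable_filt) auto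
  show "L2 M (filt M w (Suc k)) (\<lambda>\<omega>. (w (Suc k) \<omega> $ i) *\<^sub>R g \<omega>)"
    unfolding L2_def eq
  proof
    have "(\<lambda>v::real^'d. v $ i) \<in> borel_measurable borel"
      by (intro borel_measurable_continuous_onI continuous_intros)
    then show "(\<lambda>\<omega>. w (Suc k) \<omega> $ i *\<^sub>R g \<omega>) \<in> borel_measurable (filt M w (Suc k))"
      by measurable
    show "integrable M (\<lambda>\<omega>. (norm (g \<omega>))\<^sup>2 * (w (Suc k) \<omega> $ i)\<^sup>2)"
      using indep_var_integrable[OF ind] g var(1) by (auto simp: L2_def)
  qed
  show "(\<integral>\<omega>. (norm ((w (Suc k) \<omega> $ i) *\<^sub>R g \<omega>))\<^sup>2 \<partial>M) = (\<integral>\<omega>. (norm (g \<omega>))\<^sup>2 \<partial>M)"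
    unfolding eq using indep_var_lebesgue_integral[OF ind] g var by (simp add: L2_def)
qed

section \<open>Conditional expectations of vectors multiplied by noise\<close>

lemma L2_vecI:
  fixes f :: "'a \<Rightarrow> 'b::euclidean_space^'d::finite"
  assumes "\<And>i. L2 M F (\<lambda>\<omega>. f \<omega> $ i)"
  shows "L2 M F f"
proof -
  have "f \<in> borel_measurable F"
  proof (subst borel_measurable_euclidean_space, rule ballI)
    fix e :: "'b^'d" assume "e \<in> Basis"
    then obtain i u where "e = axis i u" by (auto simp: Basis_vec_def)
    then show "(\<lambda>\<omega>. f \<omega> \<bullet> e) \<in> borel_measurable F"
      using L2_measurable[OF assms] by (simp add: inner_axis borel_measurable_inner)
  qed
  moreover have "integrable M (\<lambda>\<omega>. (norm (f \<omega>))\<^sup>2)"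
  proof -
    have "(norm (f \<omega>))\<^sup>2 = (\<Sum>i\<in>UNIV. (norm (f \<omega> $ i))\<^sup>2)" for \<omega>
      by (simp add: norm_vec_def L2_set_def sum_nonneg)
    then show ?thesis using assms by (simp add: L2_def)
  qed
  ultimately show ?thesis by (simp add: L2_def)
qed

lemma L2_vec_nth:
  fixes f :: "'a \<Rightarrow> 'b::euclidean_space^'d::finite"
  assumes F: "subalgebra M F" and f: "L2 M F f"
  shows "L2 M F (\<lambda>\<omega>. f \<omega> $ i)"
proof (rule L2_bound[OF F L2_integrable[OF f]])
  have "(\<lambda>v::'b^'d. v $ i) \<in> borel_measurable borel"
    by (intro borel_measurable_continuous_onI continuous_intros)
  with L2_measurable[OF f] show "(\<lambda>\<omega>. f \<omega> $ i) \<in> borel_measurable F" by simp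
  show "norm (f \<omega> $ i) \<le> norm (f \<omega>)" for \<omega> by (rule Finite_Cartesian_Product.norm_nth_le)
qed

text \<open>Multiplication by \<open>W\<close> is a contraction from the square integrable functions
  on \<open>F\<close> into \<open>L2\<close>, although \<open>W\<close> may be unbounded. The
  instances are the constant 1, which yields \<open>p\<close>, and the noise coordinates, which
  yield \<open>q\<close>.\<close>

definition L2_multiplier :: "'a measure \<Rightarrow> 'a measure \<Rightarrow> ('a \<Rightarrow> real) \<Rightarrow> bool" where
  "L2_multiplier M F W \<longleftrightarrow> W \<in> borel_measurable M \<and> (\<forall>g::'a \<Rightarrow> real. L2 M F g \<longrightarrow>
     L2 M M (\<lambda>\<omega>. W \<omega> * g \<omega>) \<and> (\<integral>\<omega>. (W \<omega> * g \<omega>)\<^sup>2 \<partial>M) \<le> (\<integral>\<omega>. (g \<omega>)\<^sup>2 \<partial>M))"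

lemma L2_multiplier_1: "subalgebra M F \<Longrightarrow> L2_multiplier M F (\<lambda>_. 1)"
  by (auto simp: L2_multiplier_def L2_subalgebra)

context finite_measure_subalgebra
begin

text \<open>A duality argument: pairing the truncations of the conditional expectation with
  \<open>W * G\<close> bounds their \<open>L2\<close> norms by that of \<open>G\<close>.\<close>
lemma real_cond_exp_multiplier_L2:
  assumes W: "L2_multiplier M F W" and G: "L2 M M G"
  shows "L2 M F (real_cond_exp M F (\<lambda>\<omega>. W \<omega> * G \<omega>))"
proof -
  interpret sigma_finite_subalgebra M F
    by (rule finite_measure_subalgebra_is_sigma_finite) unfold_locales
  define q where "q = real_cond_exp M F (\<lambda>\<omega>. W \<omega> * G \<omega>)"
  \<comment> \<open>Each truncation is bounded and \<open>F\<close>-measurable, hence a legitimate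
    test function before anything is known about the integrability of \<open>q\<close>
    squared.\<close>
  define qn where "qn n \<omega> = (if \<bar>q \<omega>\<bar> \<le> real n then q \<omega> else 0)" for n :: nat and \<omega>
  have qF[measurable]: "q \<in> borel_measurable F" unfolding q_def by simp
  have qM[measurable]: "q \<in> borel_measurable M" by (rule measurable_subalgebra[OF subalg qF])
  have [measurable]: "G \<in> borel_measurable M" "W \<in> borel_measurable M"
    using G W by (auto simp: L2_def L2_multiplier_def)
  have qnF: "qn n \<in> borel_measurable F" for n unfolding qn_def by measurable
  have qnM[measurable]: "qn n \<in> borel_measurable M" for n by (rule measurable_subalgebra[OF subalg qnF])
  have L2qn: "L2 M F (qn n)" for n
    by (rule L2_bound[OF subalg _ qnF, where g="\<lambda>_. real n"]) (auto simp: qn_def)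
  have bound: "(\<integral>\<omega>. (qn n \<omega>)\<^sup>2 \<partial>M) \<le> (\<integral>\<omega>. (G \<omega>)\<^sup>2 \<partial>M)" for n
  proof -
    have Wq: "L2 M M (\<lambda>\<omega>. W \<omega> * qn n \<omega>)" "(\<integral>\<omega>. (W \<omega> * qn n \<omega>)\<^sup>2 \<partial>M) \<le> (\<integral>\<omega>. (qn n \<omega>)\<^sup>2 \<partial>M)"
      using W L2qn by (auto simp: L2_multiplier_def)
    have int: "integrable M (\<lambda>\<omega>. (W \<omega> * qn n \<omega>) * G \<omega>)" by (rule integrable_mult_L2[OF Wq(1) G])
    have "(\<integral>\<omega>. (qn n \<omega>)\<^sup>2 \<partial>M) = (\<integral>\<omega>. qn n \<omega> * q \<omega> \<partial>M)"
      by (rule Bochner_Integration.integral_cong) (auto simp: qn_def power2_eq_square)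
    also have "\<dots> = (\<integral>\<omega>. qn n \<omega> * (W \<omega> * G \<omega>) \<partial>M)"
      unfolding q_def by (rule real_cond_exp_intg) (use int qnF in \<open>auto simp: ac_simps\<close>)
    \<comment> \<open>Young's inequality with equal weights: by the contraction property half of the
      left-hand side reappears on the right. It is finite thanks to the truncation, so it can be
      absorbed.\<close>
    also have "\<dots> \<le> (\<integral>\<omega>. (1/2) * (W \<omega> * qn n \<omega>)\<^sup>2 + (1/2) * (G \<omega>)\<^sup>2 \<partial>M)"
    proof (rule integral_mono)
      show "integrable M (\<lambda>\<omega>. qn n \<omega> * (W \<omega> * G \<omega>))" using int by (simp add: ac_simps)
      show "integrable M (\<lambda>\<omega>. (1/2) * (W \<omega> * qn n \<omega>)\<^sup>2 + (1/2) * (G \<omega>)\<^sup>2)"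
        using Wq(1) G by (auto simp: L2_def)
      show "qn n \<omega> * (W \<omega> * G \<omega>) \<le> (1/2) * (W \<omega> * qn n \<omega>)\<^sup>2 + (1/2) * (G \<omega>)\<^sup>2" for \<omega>
        using sum_squares_bound[of "W \<omega> * qn n \<omega>" "G \<omega>"] by (simp add: ac_simps)
    qed
    also have "\<dots> = (1/2) * (\<integral>\<omega>. (W \<omega> * qn n \<omega>)\<^sup>2 \<partial>M) + (1/2) * (\<integral>\<omega>. (G \<omega>)\<^sup>2 \<partial>M)"
      using Wq(1) G by (subst Bochner_Integration.integral_add) (auto simp: L2_def)
    finally show ?thesis using Wq(2) by linarith
  qed
  have "integrable M (\<lambda>\<omega>. (q \<omega>)\<^sup>2)"
  proof (rule integrableI_bounded)
    \<comment> \<open>At each point the truncations eventually equal \<open>q\<close>, so Fatou's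
      lemma carries the uniform bound over.\<close>
    have "(\<integral>\<^sup>+\<omega>. ennreal (norm ((q \<omega>)\<^sup>2)) \<partial>M) \<le> (\<integral>\<^sup>+\<omega>. liminf (\<lambda>n. ennreal ((qn n \<omega>)\<^sup>2)) \<partial>M)"
    proof (rule nn_integral_mono)
      fix \<omega>
      obtain m where m: "\<bar>q \<omega>\<bar> \<le> real m" using real_arch_simple by blast
      have "\<forall>\<^sub>F n in sequentially. ennreal ((q \<omega>)\<^sup>2) \<le> ennreal ((qn n \<omega>)\<^sup>2)"
        using eventually_ge_at_top[of m] by eventually_elim (use m in \<open>auto simp: qn_def\<close>)
      then show "ennreal (norm ((q \<omega>)\<^sup>2)) \<le> liminf (\<lambda>n. ennreal ((qn n \<omega>)\<^sup>2))"
        by (simp add: Liminf_bounded)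
    qed
    also have "\<dots> \<le> liminf (\<lambda>n. \<integral>\<^sup>+\<omega>. ennreal ((qn n \<omega>)\<^sup>2) \<partial>M)"
      by (rule nn_integral_liminf) simp
    also have "\<dots> \<le> liminf (\<lambda>n. ennreal (\<integral>\<omega>. (G \<omega>)\<^sup>2 \<partial>M))"
    proof (rule Liminf_mono, rule always_eventually, rule allI)
      fix n
      have "(\<integral>\<^sup>+\<omega>. ennreal ((qn n \<omega>)\<^sup>2) \<partial>M) = ennreal (\<integral>\<omega>. (qn n \<omega>)\<^sup>2 \<partial>M)"
        using L2qn[of n] by (intro nn_integral_eq_integral) (auto simp: L2_def)
      then show "(\<integral>\<^sup>+\<omega>. ennreal ((qn n \<omega>)\<^sup>2) \<partial>M) \<le> ennreal (\<integral>\<omega>. (G \<omega>)\<^sup>2 \<partial>M)"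
        using bound[of n] by (simp add: ennreal_leI)
    qed
    also have "\<dots> < \<infinity>" by (simp add: Liminf_const)
    finally show "(\<integral>\<^sup>+\<omega>. ennreal (norm ((q \<omega>)\<^sup>2)) \<partial>M) < \<infinity>" .
  qed simp
  then show ?thesis using qF unfolding q_def by (simp add: L2_def)
qed

lemma cond_exp_vec_L2:
  fixes G :: "'a \<Rightarrow> real^'n::finite"
  assumes W: "L2_multiplier M F W" and G: "L2 M M G"
  shows "L2 M F (cond_exp_vec M F (\<lambda>\<omega>. W \<omega> *\<^sub>R G \<omega>))"
  unfolding cond_exp_vec_def
  by (rule L2_vecI) (simp add: real_cond_exp_multiplier_L2[OF W L2_vec_nth[OF subalgebra_refl G]])

text \<open>This is the adjoint relation behind the duality formula: against an
  \<open>F\<close>-measurable partner the conditioning disappears and the multiplier moves to that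
  partner. The contraction property of \<open>W\<close> supplies the integrability of each component
  product.\<close>

lemma integral_cond_exp_vec:
  fixes G y :: "'a \<Rightarrow> real^'n::finite"
  assumes W: "L2_multiplier M F W" and G: "L2 M M G" and y: "L2 M F y"
  shows "(\<integral>\<omega>. cond_exp_vec M F (\<lambda>\<omega>. W \<omega> *\<^sub>R G \<omega>) \<omega> \<bullet> y \<omega> \<partial>M) = (\<integral>\<omega>. G \<omega> \<bullet> (W \<omega> *\<^sub>R y \<omega>) \<partial>M)"
proof -
  interpret sigma_finite_subalgebra M F
    by (rule finite_measure_subalgebra_is_sigma_finite) unfold_locales
  let ?e = "\<lambda>j. real_cond_exp M F (\<lambda>\<omega>. W \<omega> * G \<omega> $ j)"
  have [measurable]: "W \<in> borel_measurable M" using W by (simp add: L2_multiplier_def)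
  have Gj: "L2 M M (\<lambda>\<omega>. G \<omega> $ j)" and yj: "L2 M F (\<lambda>\<omega>. y \<omega> $ j)" for j
    using L2_vec_nth[OF subalgebra_refl G] L2_vec_nth[OF subalg y] by auto
  have int: "integrable M (\<lambda>\<omega>. y \<omega> $ j * (W \<omega> * G \<omega> $ j))" for j
  proof -
    have "L2 M M (\<lambda>\<omega>. W \<omega> * y \<omega> $ j)" using W yj by (auto simp: L2_multiplier_def)
    from integrable_mult_L2[OF this Gj[of j]] show ?thesis by (simp add: ac_simps)
  qed
  have meas: "(\<lambda>\<omega>. W \<omega> * G \<omega> $ j) \<in> borel_measurable M" for j
    using L2_measurable[OF Gj] by measurable
  note ce = real_cond_exp_intg[OF int L2_measurable[OF yj] meas]
  have "(\<integral>\<omega>. cond_exp_vec M F (\<lambda>\<omega>. W \<omega> *\<^sub>R G \<omega>) \<omega> \<bullet> y \<omega> \<partial>M)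
      = (\<integral>\<omega>. (\<Sum>j\<in>UNIV. y \<omega> $ j * ?e j \<omega>) \<partial>M)"
    by (simp add: cond_exp_vec_def inner_vec_def mult.commute)
  also have "\<dots> = (\<Sum>j\<in>UNIV. \<integral>\<omega>. y \<omega> $ j * (W \<omega> * G \<omega> $ j) \<partial>M)"
    using ce by (subst Bochner_Integration.integral_sum) auto
  also have "\<dots> = (\<integral>\<omega>. (\<Sum>j\<in>UNIV. y \<omega> $ j * (W \<omega> * G \<omega> $ j)) \<partial>M)"
    using int by (subst Bochner_Integration.integral_sum) auto
  also have "\<dots> = (\<integral>\<omega>. G \<omega> \<bullet> (W \<omega> *\<^sub>R y \<omega>) \<partial>M)"
    by (simp add: inner_vec_def ac_simps sum_distrib_left)
  finally show ?thesis .
qed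

end

section \<open>Gradients and tangent directions\<close>

lemma grad_inner:
  assumes "(f has_derivative D) (at x)"
  shows "grad f x \<bullet> h = D h"
proof -
  have lin: "linear D" using assms has_derivative_linear by blast
  have "h = (\<Sum>j\<in>UNIV. (h $ j) *\<^sub>R axis j 1)"
    by (simp add: vec_eq_iff axis_def if_distrib[of "(*) _"] cong: if_cong)
  then have "D h = (\<Sum>j\<in>UNIV. (h $ j) *\<^sub>R D (axis j 1))"
    using linear_sum[OF lin, of "\<lambda>j. (h $ j) *\<^sub>R axis j 1" UNIV] linear_scale[OF lin] by simp
  then show ?thesis
    using frechet_derivative_at[OF assms] by (simp add: grad_def inner_vec_def mult.commute)
qed

lemma has_derivative_fst_slice:
  assumes "((\<lambda>z. f (fst z) (snd z)) has_derivative D) (at (x, u))"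
  shows "((\<lambda>x'. f x' u) has_derivative (\<lambda>h. D (h, 0))) (at x)"
proof -
  have "((\<lambda>x'. (x', u)) has_derivative (\<lambda>h. (h, 0))) (at x)"
    by (auto intro!: derivative_eq_intros)
  from has_derivative_compose[OF this assms] show ?thesis by simp
qed

lemma has_derivative_snd_slice:
  assumes "((\<lambda>z. f (fst z) (snd z)) has_derivative D) (at (x, u))"
  shows "((\<lambda>u'. f x u') has_derivative (\<lambda>h. D (0, h))) (at u)"
proof -
  have "((\<lambda>u'. (x, u')) has_derivative (\<lambda>h. (0, h))) (at u)"
    by (auto intro!: derivative_eq_intros)
  from has_derivative_compose[OF this assms] show ?thesis by simp
qed

lemma L2_inner_deriv:
  fixes D :: "'b::euclidean_space \<Rightarrow> 'b \<Rightarrow>\<^sub>L 'c::euclidean_space"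
  assumes F: "subalgebra M F" and D: "continuous_on UNIV D" "\<And>z. norm (D z) \<le> L"
    and Z: "Z \<in> borel_measurable F" and p: "L2 M F p"
  shows "L2 M F (\<lambda>\<omega>. p \<omega> \<bullet> blinfun_apply (D (Z \<omega>)) h)"
proof (rule L2_bound[OF F])
  show "integrable M (\<lambda>\<omega>. (norm (p \<omega>) * (L * norm h))\<^sup>2)"
    using p by (auto simp: L2_def power_mult_distrib)
  show "norm (p \<omega> \<bullet> blinfun_apply (D (Z \<omega>)) h) \<le> norm (p \<omega>) * (L * norm h)" for \<omega>
  proof -
    have "norm (blinfun_apply (D (Z \<omega>)) h) \<le> L * norm h"
      using norm_blinfun[of "D (Z \<omega>)" h] mult_right_mono[OF D(2) norm_ge_zero] by (rule order_trans)
    then have "norm (p \<omega>) * norm (blinfun_apply (D (Z \<omega>)) h) \<le> norm (p \<omega>) * (L * norm h)"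
      by (rule mult_left_mono) simp
    with Cauchy_Schwarz_ineq2[of "p \<omega>" "blinfun_apply (D (Z \<omega>)) h"] show ?thesis by simp
  qed
  show "(\<lambda>\<omega>. p \<omega> \<bullet> blinfun_apply (D (Z \<omega>)) h) \<in> borel_measurable F"
    by (intro borel_measurable_inner borel_measurable_deriv_apply D Z L2_measurable[OF p]) simp
qed

text \<open>With a fixed vector \<open>h\<close>, linear growth of the derivative still gives an
  \<open>L2\<close> function. This covers the components of the gradients of \<open>ell\<close> and
  \<open>\<Phi>\<close>.\<close>

lemma L2_deriv_direction:
  fixes D :: "'b::euclidean_space \<Rightarrow> 'b \<Rightarrow>\<^sub>L 'c::euclidean_space"
  assumes "finite_measure M" and D: "continuous_on UNIV D" "\<And>z. norm (D z) \<le> c * (1 + norm z)"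
    and Z: "L2 M M Z"
  shows "L2 M M (\<lambda>\<omega>. blinfun_apply (D (Z \<omega>)) h)"
proof (rule L2_bound[OF subalgebra_refl])
  have "L2 M M (\<lambda>\<omega>. (c * norm h) *\<^sub>R (1 + norm (Z \<omega>)))"
    by (intro L2_scaleR L2_add[OF subalgebra_refl] L2_const L2_norm assms)
  then show "integrable M (\<lambda>\<omega>. (c * norm h * (1 + norm (Z \<omega>)))\<^sup>2)" by (auto simp: L2_def)
  show "norm (blinfun_apply (D (Z \<omega>)) h) \<le> c * norm h * (1 + norm (Z \<omega>))" for \<omega>
    using order_trans[OF norm_blinfun[of "D (Z \<omega>)" h] mult_right_mono[OF D(2) norm_ge_zero]]
    by (simp add: ac_simps)
  show "(\<lambda>\<omega>. blinfun_apply (D (Z \<omega>)) h) \<in> borel_measurable M"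
    by (intro borel_measurable_deriv_apply D L2_measurable[OF Z]) simp
qed

section \<open>From tangent vectors to sequences of admissible directions\<close>

lemma ctrl_set_adm: "ctrl_set M w N U \<Longrightarrow> u \<in> U \<Longrightarrow> adm M w N u"
  unfolding ctrl_set_def by (elim conjE) (erule bspec)

lemma L2norm_nonneg: "L2norm M f \<ge> 0"
  by (simp add: L2norm_def)

lemma L2norm_scaleR: "L2norm M (\<lambda>\<omega>. a *\<^sub>R f \<omega>) = \<bar>a\<bar> * L2norm M f"
  by (simp add: L2norm_def power_mult_distrib real_sqrt_mult)

lemma L2norm_scaled_tendsto_0:
  assumes F: "subalgebra M F" and f: "L2_tendsto M F f g" and t: "t \<longlonglongrightarrow> 0"
  shows "(\<lambda>j. L2norm M (\<lambda>\<omega>. t j *\<^sub>R f j \<omega>)) \<longlonglongrightarrow> 0"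
proof -
  obtain B where B: "\<And>j. (\<integral>\<omega>. (norm (f j \<omega>))\<^sup>2 \<partial>M) \<le> B" using L2_tendsto_bounded[OF F f] by blast
  show ?thesis
  proof (rule tendsto_sandwich[OF _ _ tendsto_const])
    show "\<forall>\<^sub>F j in sequentially. L2norm M (\<lambda>\<omega>. t j *\<^sub>R f j \<omega>) \<le> \<bar>t j\<bar> * sqrt B"
      unfolding L2norm_scaleR using B by (intro always_eventually allI mult_left_mono) (auto simp: L2norm_def)
    show "(\<lambda>j. \<bar>t j\<bar> * sqrt B) \<longlonglongrightarrow> 0"
      using tendsto_mult_right[OF tendsto_rabs[OF t], of "sqrt B"] by simp
  qed (simp add: L2norm_nonneg)
qed

text \<open>Otherwise the quotient would stay at or above \<open>e\<close> on the whole interval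
  from 0 to \<open>e\<close>, and so would its lower limit. Both cones are used only through this
  conclusion.\<close>

lemma contingent_cone_approx:
  assumes v: "v \<in> contingent_cone M w N U u" and e: "e > 0"
  shows "\<exists>t. 0 < t \<and> t < e \<and> distU M N U (addc u t v) / t < e"
proof (rule ccontr)
  assume "\<not> ?thesis"
  then have "\<And>t. 0 < t \<Longrightarrow> t < e \<Longrightarrow> e \<le> distU M N U (addc u t v) / t" by (meson not_le)
  then have "\<forall>\<^sub>F t in at_right 0. ereal e \<le> ereal (distU M N U (addc u t v) / t)"
    using e by (intro eventually_at_rightI[of 0 e]) auto
  then have "ereal e \<le> Liminf (at_right 0) (\<lambda>t. ereal (distU M N U (addc u t v) / t))"
    by (rule Liminf_bounded)
  with v e show False by (simp add: contingent_cone_def)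
qed

lemma clarke_cone_approx:
  assumes v: "v \<in> clarke_cone M w N U u" and u: "u \<in> U" and e: "e > 0"
  shows "\<exists>t. 0 < t \<and> t < e \<and> distU M N U (addc u t v) / t < e"
proof -
  obtain d where d: "d > 0" "\<And>t. 0 < t \<Longrightarrow> t < d \<Longrightarrow> \<bar>distU M N U (addc u t v) / t\<bar> < e"
  proof -
    \<comment> \<open>The base point itself is taken as the nearby element of \<open>U\<close> over
      which the definition quantifies.\<close>
    have "cdist M N u u = 0" by (simp add: cdist_def L2norm_def)
    with v u e that show thesis unfolding clarke_cone_def by fastforce
  qed
  define t where "t = min d e / 2"
  have "0 < t" "t < d" "t < e" using d(1) e by (auto simp: t_def min_def)
  with d(2)[of t] show ?thesis by (intro exI[of _ t]) (meson abs_ge_self le_less_trans)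
qed

text \<open>Points of \<open>U\<close> that nearly realise the distance to \<open>addc u t v\<close>
  are rewritten as \<open>u\<close> plus \<open>t\<close> times a direction. Their distance is small
  relative to \<open>t\<close>, so the directions converge to \<open>v\<close>.\<close>

lemma approximating_controls:
  assumes F: "\<And>k. k < N \<Longrightarrow> subalgebra M (filt M w k)"
    and U: "ctrl_set M w N U" and u: "u \<in> U" and v: "adm M w N v"
    and approx: "\<And>e. e > 0 \<Longrightarrow> \<exists>t. 0 < t \<and> t < e \<and> distU M N U (addc u t v) / t < e"
  obtains t vs where "t \<longlonglongrightarrow> 0" "\<And>j. t j > 0" "\<And>j. t j \<le> 1" "\<And>j. addc u (t j) (vs j) \<in> U"
    "\<And>k. k < N \<Longrightarrow> L2_tendsto M (filt M w k) (\<lambda>j. vs j k) (v k)"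
proof -
  \<comment> \<open>One null sequence bounds both the step length and the distance quotient; being
    at most 1, it also yields \<open>t j \<le> 1\<close>.\<close>
  let ?e = "\<lambda>j. 1 / real (Suc j)"
  have e0: "?e \<longlonglongrightarrow> 0" using LIMSEQ_inverse_real_of_nat by (simp add: inverse_eq_divide)
  have "\<forall>j. \<exists>t z. 0 < t \<and> t < ?e j \<and> z \<in> U \<and> cdist M N (addc u t v) z < t * ?e j"
  proof
    fix j
    obtain t where t: "0 < t" "t < ?e j" "distU M N U (addc u t v) / t < ?e j"
      using approx[of "?e j"] by auto
    then have "Inf {cdist M N (addc u t v) z | z. z \<in> U} < t * ?e j"
      by (simp add: distU_def field_simps)
    \<comment> \<open>A nearest point need not exist. Since \<open>u\<close> makes the set of
      distances nonempty, some distance lies below any number exceeding the infimum.\<close>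
    with u obtain y where "y \<in> {cdist M N (addc u t v) z | z. z \<in> U}" "y < t * ?e j"
      by (metis (mono_tags, lifting) cInf_lessD empty_iff mem_Collect_eq)
    with t show "\<exists>t z. 0 < t \<and> t < ?e j \<and> z \<in> U \<and> cdist M N (addc u t v) z < t * ?e j" by blast
  qed
  then obtain t z where tz: "\<And>j. 0 < t j" "\<And>j. t j < ?e j" "\<And>j. z j \<in> U"
    "\<And>j. cdist M N (addc u (t j) v) (z j) < t j * ?e j" by metis
  define vs where "vs j = (\<lambda>k \<omega>. (1 / t j) *\<^sub>R (z j k \<omega> - u k \<omega>))" for j
  have "addc u (t j) (vs j) = z j" for j
    using tz(1)[of j] by (simp add: addc_def vs_def)
  then have vsU: "\<And>j. addc u (t j) (vs j) \<in> U" using tz(3) by simp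
  have t0: "t \<longlonglongrightarrow> 0"
    by (rule tendsto_sandwich[OF _ _ tendsto_const e0])
      (auto intro!: always_eventually less_imp_le tz simp del: of_nat_Suc)
  have t1: "t j \<le> 1" for j
  proof -
    have "?e j \<le> 1" by simp
    then show ?thesis using tz(2)[of j] by linarith
  qed
  have adm: "adm M w N (z j)" "adm M w N u" for j
    using ctrl_set_adm[OF U tz(3)] ctrl_set_adm[OF U u] .
  have "L2_tendsto M (filt M w k) (\<lambda>j. vs j k) (v k)" if k: "k < N" for k
  proof (rule L2_tendsto_dominated)
    show "L2 M (filt M w k) (vs j k)" for j
      unfolding vs_def using adm k by (intro L2_scaleR L2_diff[OF F[OF k]]) (auto simp: adm_def)
    show "L2 M (filt M w k) (v k)" using v k by (simp add: adm_def)
    show "(\<lambda>j. (?e j)\<^sup>2) \<longlonglongrightarrow> 0" using tendsto_power[OF e0, of 2] by simp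
    fix j
    have eq: "vs j k \<omega> - v k \<omega> = (- (1 / t j)) *\<^sub>R (addc u (t j) v k \<omega> - z j k \<omega>)" for \<omega>
      using tz(1)[of j] by (simp add: vs_def addc_def algebra_simps)
    have "L2norm M (\<lambda>\<omega>. addc u (t j) v k \<omega> - z j k \<omega>) \<le> cdist M N (addc u (t j) v) (z j)"
      unfolding cdist_def using k
      by (intro member_le_sum[of k "{..<N}" "\<lambda>k. L2norm M (\<lambda>\<omega>. addc u (t j) v k \<omega> - z j k \<omega>)"])
        (auto simp: L2norm_nonneg)
    then have "L2norm M (\<lambda>\<omega>. addc u (t j) v k \<omega> - z j k \<omega>) \<le> t j * ?e j"
      using tz(4)[of j] by linarith
    then have "(1 / t j) * L2norm M (\<lambda>\<omega>. addc u (t j) v k \<omega> - z j k \<omega>) \<le> (1 / t j) * (t j * ?e j)"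
      using tz(1)[of j] by (intro mult_left_mono) auto
    then have "L2norm M (\<lambda>\<omega>. vs j k \<omega> - v k \<omega>) \<le> ?e j"
      unfolding eq L2norm_scaleR using tz(1)[of j] by simp
    from power_mono[OF this L2norm_nonneg, of 2]
    show "(\<integral>\<omega>. (norm (vs j k \<omega> - v k \<omega>))\<^sup>2 \<partial>M) \<le> (?e j)\<^sup>2"
      by (simp add: L2norm_def)
  qed
  from that[OF t0 tz(1) t1 vsU this] show thesis .
qed

section \<open>Joint derivatives from bounds on partial derivatives\<close>

definition bounded_C1 :: "('z::real_normed_vector \<Rightarrow> 'b::real_normed_vector) \<Rightarrow> ('z \<Rightarrow> 'z \<Rightarrow>\<^sub>L 'b) \<Rightarrow> ('z \<Rightarrow> real) \<Rightarrow> bool" where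
  "bounded_C1 f D B \<longleftrightarrow> (\<forall>z. (f has_derivative blinfun_apply (D z)) (at z)) \<and>
    continuous_on UNIV D \<and> (\<forall>z. norm (D z) \<le> B z)"

lemma bounded_C1D:
  assumes "bounded_C1 f D B"
  shows "(f has_derivative blinfun_apply (D z)) (at z)" "continuous_on UNIV D" "norm (D z) \<le> B z"
  using assms unfolding bounded_C1_def by blast+

text \<open>By linearity the joint derivative at a pair of increments is the sum of the two partial
  derivatives, and each component is no longer than the pair. Hence its operator norm is at most the
  sum of the partial ones.\<close>

lemma C1_map_partials:
  fixes f :: "'x::real_normed_vector \<Rightarrow> 'u::real_normed_vector \<Rightarrow> 'b::real_normed_vector"
  assumes "C1_map (\<lambda>z. f (fst z) (snd z))"
    and B: "\<And>x u. onorm (Dx f x u) + onorm (Du f x u) \<le> B x u"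
  shows "\<exists>D. bounded_C1 (\<lambda>z. f (fst z) (snd z)) D (\<lambda>z. B (fst z) (snd z))"
proof -
  obtain D where D: "\<And>z. ((\<lambda>z. f (fst z) (snd z)) has_derivative blinfun_apply (D z)) (at z)"
    "continuous_on UNIV D"
    using assms(1) by (auto simp: C1_map_def)
  have "norm (D (x, u)) \<le> B x u" for x u
  proof (rule norm_blinfun_bound)
    note dx = has_derivative_fst_slice[OF D(1)[of "(x, u)"]]
    note du = has_derivative_snd_slice[OF D(1)[of "(x, u)"]]
    have Dx: "Dx f x u = (\<lambda>h. D (x, u) (h, 0))" and Du: "Du f x u = (\<lambda>h. D (x, u) (0, h))"
      unfolding Dx_def Du_def using frechet_derivative_at[OF dx] frechet_derivative_at[OF du] by auto
    have bx: "bounded_linear (Dx f x u)" and bu: "bounded_linear (Du f x u)"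
      unfolding Dx Du using has_derivative_bounded_linear dx du by blast+
    show "0 \<le> B x u" using B[of x u] onorm_pos_le[OF bx] onorm_pos_le[OF bu] by linarith
    fix y :: "'x \<times> 'u"
    have "D (x, u) y = Dx f x u (fst y) + Du f x u (snd y)"
      unfolding Dx Du by (simp add: blinfun.add_right[symmetric])
    then have "norm (D (x, u) y) \<le> norm (Dx f x u (fst y)) + norm (Du f x u (snd y))"
      using norm_triangle_ineq by simp
    also have "\<dots> \<le> onorm (Dx f x u) * norm (fst y) + onorm (Du f x u) * norm (snd y)"
      by (intro add_mono onorm bx bu)
    also have "\<dots> \<le> onorm (Dx f x u) * norm y + onorm (Du f x u) * norm y"
      by (intro add_mono mult_left_mono onorm_pos_le bx bu norm_fst_le[of "fst y" "snd y", simplified]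
          norm_snd_le[of "snd y" "fst y", simplified])
    also have "\<dots> = (onorm (Dx f x u) + onorm (Du f x u)) * norm y" by (simp add: distrib_right)
    also have "\<dots> \<le> B x u * norm y" by (intro mult_right_mono B) simp
    finally show "norm (D (x, u) y) \<le> B x u * norm y" .
  qed
  with D show ?thesis unfolding bounded_C1_def by (intro exI[of _ D]) auto
qed

lemma L2_cong_AE:
  assumes "L2 M M f" "AE \<omega> in M. g \<omega> = f \<omega>" and [measurable]: "g \<in> borel_measurable M"
  shows "L2 M M g"
proof -
  have [measurable]: "f \<in> borel_measurable M" using assms(1) L2_measurable by blast
  have "integrable M (\<lambda>\<omega>. (norm (g \<omega>))\<^sup>2) \<longleftrightarrow> integrable M (\<lambda>\<omega>. (norm (f \<omega>))\<^sup>2)"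
    by (rule integrable_cong_AE) (use assms(2) in auto)
  with assms show ?thesis by (simp add: L2_def)
qed

text \<open>Needed because the adjoint is built from the explicit trajectory, which agrees with the
  given optimal state only almost everywhere.\<close>

lemma cond_exp_vec_cong_AE:
  fixes f g :: "'a \<Rightarrow> real^'n::finite"
  assumes "sigma_finite_subalgebra M F" and f: "f \<in> borel_measurable M" and g: "g \<in> borel_measurable M"
    and ae: "AE \<omega> in M. f \<omega> = g \<omega>"
  shows "AE \<omega> in M. cond_exp_vec M F f \<omega> = cond_exp_vec M F g \<omega>"
proof -
  interpret sigma_finite_subalgebra M F by fact
  have comp: "(\<lambda>v::real^'n. v $ j) \<in> borel_measurable borel" for j
    by (intro borel_measurable_continuous_onI continuous_intros)
  have "AE \<omega> in M. real_cond_exp M F (\<lambda>\<omega>. f \<omega> $ j) \<omega> = real_cond_exp M F (\<lambda>\<omega>. g \<omega> $ j) \<omega>" for j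
    using ae by (intro real_cond_exp_cong measurable_compose[OF f comp] measurable_compose[OF g comp]) auto
  then have "AE \<omega> in M. \<forall>j. real_cond_exp M F (\<lambda>\<omega>. f \<omega> $ j) \<omega> = real_cond_exp M F (\<lambda>\<omega>. g \<omega> $ j) \<omega>"
    by (simp add: AE_all_countable)
  then show ?thesis by eventually_elim (simp add: cond_exp_vec_def)
qed

section \<open>The controlled system\<close>

text \<open>The joint derivatives are parameters, so that the linearised equation can apply them
  directly, and a single constant \<open>c\<close> serves all bounds. Everything about the
  coefficients is required only for \<open>k < N\<close>.\<close>

locale controlled_system = prob_space M for M :: "'a measure" +
  fixes w :: "nat \<Rightarrow> 'a \<Rightarrow> real^'d::finite" and N :: nat and x0 :: "real^'n::finite"
    and b :: "nat \<Rightarrow> real^'n \<Rightarrow> real^'m::finite \<Rightarrow> real^'n"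
    and \<sigma> :: "nat \<Rightarrow> real^'n \<Rightarrow> real^'m \<Rightarrow> real^'n^'d"
    and ell :: "nat \<Rightarrow> real^'n \<Rightarrow> real^'m \<Rightarrow> real"
    and \<Phi> :: "real^'n \<Rightarrow> real"
    and Db :: "nat \<Rightarrow> (real^'n) \<times> (real^'m) \<Rightarrow> ((real^'n) \<times> (real^'m)) \<Rightarrow>\<^sub>L (real^'n)"
    and Ds :: "nat \<Rightarrow> 'd \<Rightarrow> (real^'n) \<times> (real^'m) \<Rightarrow> ((real^'n) \<times> (real^'m)) \<Rightarrow>\<^sub>L (real^'n)"
    and Dl :: "nat \<Rightarrow> (real^'n) \<times> (real^'m) \<Rightarrow> ((real^'n) \<times> (real^'m)) \<Rightarrow>\<^sub>L real"
    and DP :: "real^'n \<Rightarrow> (real^'n) \<Rightarrow>\<^sub>L real" and c :: real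
  assumes indep: "indep_vars (\<lambda>_. borel) w {1..N}"
    and var_int: "k < N \<Longrightarrow> integrable M (\<lambda>\<omega>. (w (Suc k) \<omega> $ i)\<^sup>2)"
    and var_eq: "k < N \<Longrightarrow> (\<integral>\<omega>. (w (Suc k) \<omega> $ i)\<^sup>2 \<partial>M) = 1"
    and c: "c \<ge> 0"
    and b_deriv: "k < N \<Longrightarrow> ((\<lambda>z. b k (fst z) (snd z)) has_derivative blinfun_apply (Db k z)) (at z)"
    and Db_cont: "k < N \<Longrightarrow> continuous_on UNIV (Db k)" and Db_le: "k < N \<Longrightarrow> norm (Db k z) \<le> c"
    and s_deriv: "k < N \<Longrightarrow> ((\<lambda>z. \<sigma> k (fst z) (snd z) $ i) has_derivative blinfun_apply (Ds k i z)) (at z)"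
    and Ds_cont: "k < N \<Longrightarrow> continuous_on UNIV (Ds k i)" and Ds_le: "k < N \<Longrightarrow> norm (Ds k i z) \<le> c"
    and l_deriv: "k < N \<Longrightarrow> ((\<lambda>z. ell k (fst z) (snd z)) has_derivative blinfun_apply (Dl k z)) (at z)"
    and Dl_cont: "k < N \<Longrightarrow> continuous_on UNIV (Dl k)" and Dl_le: "k < N \<Longrightarrow> norm (Dl k z) \<le> c * (1 + norm z)"
    and P_deriv: "(\<Phi> has_derivative blinfun_apply (DP x)) (at x)"
    and DP_cont: "continuous_on UNIV DP" and DP_le: "norm (DP x) \<le> c * (1 + norm x)"
begin

abbreviation F where "F k \<equiv> filt M w k"

lemma fin: "finite_measure M" by unfold_locales

lemma w_measurable: "k < N \<Longrightarrow> w (Suc k) \<in> borel_measurable M"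
  using indep by (auto simp: indep_vars_def2)

lemma subalg_F: "k \<le> N \<Longrightarrow> subalgebra M (F k)"
  using indep by (intro subalgebra_filt) (auto simp: indep_vars_def2)

lemma F_mono: "subalgebra (F (Suc k)) (F k)"
  by (rule subalgebra_filt_mono) simp

lemma noise_L2: "k < N \<Longrightarrow> L2 M (F k) g \<Longrightarrow> L2 M (F (Suc k)) (\<lambda>\<omega>. (w (Suc k) \<omega> $ i) *\<^sub>R g \<omega>)"
  by (rule noise_isometry(1)[OF indep _ var_int var_eq]) auto

lemma noise_norm:
  "k < N \<Longrightarrow> L2 M (F k) g \<Longrightarrow>
    (\<integral>\<omega>. (norm ((w (Suc k) \<omega> $ i) *\<^sub>R g \<omega>))\<^sup>2 \<partial>M) = (\<integral>\<omega>. (norm (g \<omega>))\<^sup>2 \<partial>M)"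
  by (rule noise_isometry(2)[OF indep _ var_int var_eq]) auto

lemma noise_multiplier: "k < N \<Longrightarrow> L2_multiplier M (F k) (\<lambda>\<omega>. w (Suc k) \<omega> $ i)"
  unfolding L2_multiplier_def
proof (intro conjI allI impI)
  assume k: "k < N"
  have "(\<lambda>v::real^'d. v $ i) \<in> borel_measurable borel"
    by (intro borel_measurable_continuous_onI continuous_intros)
  from measurable_compose[OF w_measurable[OF k] this]
  show "(\<lambda>\<omega>. w (Suc k) \<omega> $ i) \<in> borel_measurable M" .
  fix g :: "'a \<Rightarrow> real" assume g: "L2 M (F k) g"
  show "L2 M M (\<lambda>\<omega>. w (Suc k) \<omega> $ i * g \<omega>)"
    using L2_subalgebra[OF subalg_F noise_L2[OF k g, of i]] k by simp
  show "(\<integral>\<omega>. (w (Suc k) \<omega> $ i * g \<omega>)\<^sup>2 \<partial>M) \<le> (\<integral>\<omega>. (g \<omega>)\<^sup>2 \<partial>M)"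
    using noise_norm[OF k g, of i] by (simp add: power_mult_distrib)
qed

lemma step_L2:
  assumes k: "k < N" and "L2 M (F k) f" "\<And>i. L2 M (F k) (g i)"
  shows "L2 M (F (Suc k)) (\<lambda>\<omega>. f \<omega> + (\<Sum>i\<in>UNIV. (w (Suc k) \<omega> $ i) *\<^sub>R g i \<omega>))"
  using k by (intro L2_add[OF subalg_F] L2_sum[OF subalg_F] noise_L2 L2_subalgebra[OF F_mono] assms) auto

text \<open>By linearity the error of a noise term is again noise times an error of the past, and
  the isometry makes its \<open>L2\<close> size equal to that of the coefficient error.\<close>

lemma step_tendsto:
  assumes k: "k < N" and f: "L2_tendsto M (F k) f f'" and g: "\<And>i. L2_tendsto M (F k) (g i) (g' i)"
  shows "L2_tendsto M (F (Suc k)) (\<lambda>j \<omega>. f j \<omega> + (\<Sum>i\<in>UNIV. (w (Suc k) \<omega> $ i) *\<^sub>R g i j \<omega>))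
    (\<lambda>\<omega>. f' \<omega> + (\<Sum>i\<in>UNIV. (w (Suc k) \<omega> $ i) *\<^sub>R g' i \<omega>))"
proof -
  have F: "subalgebra M (F (Suc k))" using k by (intro subalg_F) simp
  have "L2_tendsto M (F (Suc k)) (\<lambda>j \<omega>. (w (Suc k) \<omega> $ i) *\<^sub>R g i j \<omega>) (\<lambda>\<omega>. (w (Suc k) \<omega> $ i) *\<^sub>R g' i \<omega>)" for i
  proof (rule L2_tendsto_dominated)
    have gi: "L2 M (F k) (g i j)" "L2 M (F k) (g' i)" for j using g[of i] by (auto simp: L2_tendsto_def)
    show "L2 M (F (Suc k)) (\<lambda>\<omega>. (w (Suc k) \<omega> $ i) *\<^sub>R g i j \<omega>)"
      "L2 M (F (Suc k)) (\<lambda>\<omega>. (w (Suc k) \<omega> $ i) *\<^sub>R g' i \<omega>)" for j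
      by (intro noise_L2 k gi)+
    show "(\<lambda>j. \<integral>\<omega>. (norm (g i j \<omega> - g' i \<omega>))\<^sup>2 \<partial>M) \<longlonglongrightarrow> 0"
      using g[of i] by (simp add: L2_tendsto_def)
    show "(\<integral>\<omega>. (norm ((w (Suc k) \<omega> $ i) *\<^sub>R g i j \<omega> - (w (Suc k) \<omega> $ i) *\<^sub>R g' i \<omega>))\<^sup>2 \<partial>M)
        \<le> (\<integral>\<omega>. (norm (g i j \<omega> - g' i \<omega>))\<^sup>2 \<partial>M)" for j
      using noise_norm[OF k L2_diff[OF subalg_F gi(1) gi(2)], of i j] k
      by (simp add: scaleR_diff_right)
  qed
  then show ?thesis
    by (intro L2_tendsto_add[OF F] L2_tendsto_sum[OF F] L2_tendsto_subalgebra[OF F_mono f])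
qed

text \<open>A version of the state defined at every point of the space, so that it can be
  manipulated without exceptional null sets.\<close>

primrec traj :: "(nat \<Rightarrow> 'a \<Rightarrow> real^'m) \<Rightarrow> nat \<Rightarrow> 'a \<Rightarrow> real^'n" where
  "traj u 0 = (\<lambda>\<omega>. x0)"
| "traj u (Suc k) = (\<lambda>\<omega>. b k (traj u k \<omega>) (u k \<omega>)
     + (\<Sum>i\<in>UNIV. (w (Suc k) \<omega> $ i) *\<^sub>R (\<sigma> k (traj u k \<omega>) (u k \<omega>) $ i)))"

text \<open>The formal derivative of \<open>traj\<close> at \<open>u\<close> in direction
  \<open>v\<close>; it starts at 0 because the initial state is not varied.\<close>

primrec lin :: "(nat \<Rightarrow> 'a \<Rightarrow> real^'m) \<Rightarrow> (nat \<Rightarrow> 'a \<Rightarrow> real^'m) \<Rightarrow> nat \<Rightarrow> 'a \<Rightarrow> real^'n" where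
  "lin u v 0 = (\<lambda>\<omega>. 0)"
| "lin u v (Suc k) = (\<lambda>\<omega>. blinfun_apply (Db k (traj u k \<omega>, u k \<omega>)) (lin u v k \<omega>, v k \<omega>)
     + (\<Sum>i\<in>UNIV. (w (Suc k) \<omega> $ i) *\<^sub>R
          blinfun_apply (Ds k i (traj u k \<omega>, u k \<omega>)) (lin u v k \<omega>, v k \<omega>)))"

lemma adm_L2: "adm M w N u \<Longrightarrow> k < N \<Longrightarrow> L2 M (F k) (u k)"
  by (simp add: adm_def)

lemma coeff_L2:
  assumes k: "k < N" and "L2 M (F k) x" "L2 M (F k) u"
  shows "L2 M (F k) (\<lambda>\<omega>. b k (x \<omega>) (u \<omega>))" "L2 M (F k) (\<lambda>\<omega>. \<sigma> k (x \<omega>) (u \<omega>) $ i)"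
proof -
  have F: "subalgebra M (F k)" using k by (intro subalg_F) simp
  note Z = L2_Pair[OF assms(2,3)]
  show "L2 M (F k) (\<lambda>\<omega>. b k (x \<omega>) (u \<omega>))"
    using L2_Lipschitz_comp[OF fin F b_deriv[OF k] Db_le[OF k] Z] by simp
  show "L2 M (F k) (\<lambda>\<omega>. \<sigma> k (x \<omega>) (u \<omega>) $ i)"
    using L2_Lipschitz_comp[OF fin F s_deriv[OF k] Ds_le[OF k] Z] by simp
qed

lemma traj_L2: "adm M w N u \<Longrightarrow> k \<le> N \<Longrightarrow> L2 M (F k) (traj u k)"
proof (induction k)
  case 0
  then show ?case by (simp add: L2_const[OF fin])
next
  case (Suc k)
  then have k: "k < N" and x: "L2 M (F k) (traj u k)" and u: "L2 M (F k) (u k)"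
    by (auto simp: adm_L2)
  show ?case
    unfolding traj.simps by (intro step_L2 coeff_L2 k x u)
qed

text \<open>Induction over time: the state quotient at time \<open>k\<close>, paired with the
  control direction, is a convergent moving direction for the coefficients at time \<open>k\<close>,
  and \<open>step_tendsto\<close> carries the resulting limits through the noise.\<close>

lemma traj_tendsto:
  assumes u: "adm M w N u" and v: "\<And>k. k < N \<Longrightarrow> L2_tendsto M (F k) (\<lambda>j. vs j k) (v k)"
    and t: "t \<longlonglongrightarrow> 0" "\<And>j. t j > 0"
  shows "k \<le> N \<Longrightarrow> L2_tendsto M (F k)
     (\<lambda>j \<omega>. (1 / t j) *\<^sub>R (traj (addc u (t j) (vs j)) k \<omega> - traj u k \<omega>)) (lin u v k)"
proof (induction k)
  case 0
  then show ?case by (simp add: L2_tendsto_def L2_def)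
next
  case (Suc k)
  let ?u = "\<lambda>j. addc u (t j) (vs j)"
  let ?q = "\<lambda>j \<omega>. (1 / t j) *\<^sub>R (traj (?u j) k \<omega> - traj u k \<omega>)"
  let ?Z = "\<lambda>\<omega>. (traj u k \<omega>, u k \<omega>)" and ?Y = "\<lambda>j \<omega>. (?q j \<omega>, vs j k \<omega>)"
  from Suc have k: "k < N" by simp
  have F: "subalgebra M (F k)" using k by (intro subalg_F) simp
  have Y: "L2_tendsto M (F k) ?Y (\<lambda>\<omega>. (lin u v k \<omega>, v k \<omega>))"
    using Suc.IH k by (intro L2_tendsto_Pair[OF F] v) auto
  have Z: "L2 M (F k) ?Z" using k by (intro L2_Pair traj_L2 adm_L2 u) auto
  \<comment> \<open>Moving by \<open>t j\<close> along the state quotient gives exactly the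
    perturbed pair, with no remainder, so the result on difference quotients applies
    verbatim.\<close>
  have ZY: "?Z \<omega> + t j *\<^sub>R ?Y j \<omega> = (traj (?u j) k \<omega>, ?u j k \<omega>)" for j \<omega>
    using t(2)[of j] by (simp add: addc_def)
  let ?b = "\<lambda>j \<omega>. (1 / t j) *\<^sub>R (b k (traj (?u j) k \<omega>) (?u j k \<omega>) - b k (traj u k \<omega>) (u k \<omega>))"
  let ?s = "\<lambda>i j \<omega>. (1 / t j) *\<^sub>R (\<sigma> k (traj (?u j) k \<omega>) (?u j k \<omega>) $ i - \<sigma> k (traj u k \<omega>) (u k \<omega>) $ i)"
  have 1: "L2_tendsto M (F k) ?b (\<lambda>\<omega>. blinfun_apply (Db k (?Z \<omega>)) (lin u v k \<omega>, v k \<omega>))"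
    using L2_tendsto_difference_quotient[OF fin F b_deriv[OF k] Db_cont[OF k] Db_le[OF k] Z Y t]
    unfolding ZY by simp
  have 2: "L2_tendsto M (F k) (?s i) (\<lambda>\<omega>. blinfun_apply (Ds k i (?Z \<omega>)) (lin u v k \<omega>, v k \<omega>))" for i
    using L2_tendsto_difference_quotient[OF fin F s_deriv[OF k] Ds_cont[OF k] Ds_le[OF k] Z Y t]
    unfolding ZY by simp
  have "(1 / t j) *\<^sub>R (traj (?u j) (Suc k) \<omega> - traj u (Suc k) \<omega>)
      = ?b j \<omega> + (\<Sum>i\<in>UNIV. (w (Suc k) \<omega> $ i) *\<^sub>R ?s i j \<omega>)" for j \<omega>
    by (simp add: scaleR_diff_right scaleR_add_right scaleR_sum_right sum_subtractf mult.commute)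
  with step_tendsto[OF k 1 2] show ?case by (simp only: lin.simps)
qed

text \<open>Square integrability and adaptedness are part of the notion of limit, so it suffices to
  use the constant direction \<open>v\<close> with steps \<open>1 / (j + 1)\<close>.\<close>

lemma lin_L2:
  assumes u: "adm M w N u" and v: "adm M w N v" and k: "k \<le> N"
  shows "L2 M (F k) (lin u v k)"
  using traj_tendsto[OF u, of "\<lambda>_. v" v "\<lambda>j. 1 / real (Suc j)", OF _ _ _ k] v
    LIMSEQ_inverse_real_of_nat
  by (simp add: L2_tendsto_def adm_def inverse_eq_divide)

section \<open>The directional derivative of the cost\<close>

lemma cost_traj:
  assumes u: "adm M w N u"
  shows "cost M N ell \<Phi> (traj u) u
    = (\<Sum>k<N. \<integral>\<omega>. ell k (traj u k \<omega>) (u k \<omega>) \<partial>M) + (\<integral>\<omega>. \<Phi> (traj u N \<omega>) \<partial>M)"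
    and "k < N \<Longrightarrow> integrable M (\<lambda>\<omega>. ell k (traj u k \<omega>) (u k \<omega>))"
    and "integrable M (\<lambda>\<omega>. \<Phi> (traj u N \<omega>))"
proof -
  have P: "integrable M (\<lambda>\<omega>. \<Phi> (traj u N \<omega>))"
    by (rule integrable_quadratic_growth[OF fin P_deriv DP_le c])
      (rule L2_subalgebra[OF subalg_F traj_L2[OF u]]; simp)
  have l: "integrable M (\<lambda>\<omega>. ell k (traj u k \<omega>) (u k \<omega>))" if k: "k < N" for k
  proof -
    have "L2 M M (\<lambda>\<omega>. (traj u k \<omega>, u k \<omega>))"
      using k by (intro L2_subalgebra[OF subalg_F[of k]] L2_Pair traj_L2 adm_L2 u) auto
    from integrable_quadratic_growth[OF fin l_deriv[OF k] Dl_le[OF k] c this] show ?thesis by simp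
  qed
  show "cost M N ell \<Phi> (traj u) u
    = (\<Sum>k<N. \<integral>\<omega>. ell k (traj u k \<omega>) (u k \<omega>) \<partial>M) + (\<integral>\<omega>. \<Phi> (traj u N \<omega>) \<partial>M)"
    unfolding cost_def using l P
    by (subst Bochner_Integration.integral_add) (auto simp: Bochner_Integration.integral_sum)
  show "k < N \<Longrightarrow> integrable M (\<lambda>\<omega>. ell k (traj u k \<omega>) (u k \<omega>))" by (rule l)
  show "integrable M (\<lambda>\<omega>. \<Phi> (traj u N \<omega>))" by (rule P)
qed

lemma cost_tendsto:
  assumes u: "adm M w N u" and us: "\<And>j. adm M w N (addc u (t j) (vs j))"
    and v: "\<And>k. k < N \<Longrightarrow> L2_tendsto M (F k) (\<lambda>j. vs j k) (v k)"
    and t: "t \<longlonglongrightarrow> 0" "\<And>j. t j > 0" "\<And>j. t j \<le> 1"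
  shows "(\<lambda>j. (1 / t j) * (cost M N ell \<Phi> (traj (addc u (t j) (vs j))) (addc u (t j) (vs j))
        - cost M N ell \<Phi> (traj u) u))
     \<longlonglongrightarrow> (\<Sum>k<N. \<integral>\<omega>. blinfun_apply (Dl k (traj u k \<omega>, u k \<omega>)) (lin u v k \<omega>, v k \<omega>) \<partial>M)
        + (\<integral>\<omega>. blinfun_apply (DP (traj u N \<omega>)) (lin u v N \<omega>) \<partial>M)"
proof -
  let ?u = "\<lambda>j. addc u (t j) (vs j)"
  let ?q = "\<lambda>k j \<omega>. (1 / t j) *\<^sub>R (traj (?u j) k \<omega> - traj u k \<omega>)"
  have q: "L2_tendsto M M (?q k) (lin u v k)" if "k \<le> N" for k
    using L2_tendsto_subalgebra[OF subalg_F[OF that] traj_tendsto[OF u v t(1,2) that]] .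
  have 1: "(\<lambda>j. \<integral>\<omega>. (1 / t j) * (ell k (traj (?u j) k \<omega>) (?u j k \<omega>) - ell k (traj u k \<omega>) (u k \<omega>)) \<partial>M)
      \<longlonglongrightarrow> (\<integral>\<omega>. blinfun_apply (Dl k (traj u k \<omega>, u k \<omega>)) (lin u v k \<omega>, v k \<omega>) \<partial>M)" if k: "k < N" for k
  proof -
    let ?Z = "\<lambda>\<omega>. (traj u k \<omega>, u k \<omega>)" and ?Y = "\<lambda>j \<omega>. (?q k j \<omega>, vs j k \<omega>)"
    have Z: "L2 M M ?Z"
      using k by (intro L2_subalgebra[OF subalg_F[of k]] L2_Pair traj_L2 adm_L2 u) auto
    have Y: "L2_tendsto M M ?Y (\<lambda>\<omega>. (lin u v k \<omega>, v k \<omega>))"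
      using k by (intro L2_tendsto_Pair[OF subalgebra_refl] q L2_tendsto_subalgebra[OF subalg_F[of k] v]) auto
    have ZY: "?Z \<omega> + t j *\<^sub>R ?Y j \<omega> = (traj (?u j) k \<omega>, ?u j k \<omega>)" for j \<omega>
      using t(2)[of j] by (simp add: addc_def)
    show ?thesis
      using integral_difference_quotient_tendsto[OF fin l_deriv[OF k] Dl_cont[OF k] Dl_le[OF k] c Z Y t]
      unfolding ZY by simp
  qed
  have 2: "(\<lambda>j. \<integral>\<omega>. (1 / t j) * (\<Phi> (traj (?u j) N \<omega>) - \<Phi> (traj u N \<omega>)) \<partial>M)
      \<longlonglongrightarrow> (\<integral>\<omega>. blinfun_apply (DP (traj u N \<omega>)) (lin u v N \<omega>) \<partial>M)"
  proof -
    have Z: "L2 M M (traj u N)" by (rule L2_subalgebra[OF subalg_F traj_L2[OF u]]) auto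
    have ZY: "traj u N \<omega> + t j *\<^sub>R ?q N j \<omega> = traj (?u j) N \<omega>" for j \<omega>
      using t(2)[of j] by simp
    show ?thesis
      using integral_difference_quotient_tendsto[OF fin P_deriv DP_cont DP_le c Z q[OF order_refl] t]
      unfolding ZY by simp
  qed
  have "(1 / t j) * (cost M N ell \<Phi> (traj (?u j)) (?u j) - cost M N ell \<Phi> (traj u) u)
     = (\<Sum>k<N. \<integral>\<omega>. (1 / t j) * (ell k (traj (?u j) k \<omega>) (?u j k \<omega>) - ell k (traj u k \<omega>) (u k \<omega>)) \<partial>M)
      + (\<integral>\<omega>. (1 / t j) * (\<Phi> (traj (?u j) N \<omega>) - \<Phi> (traj u N \<omega>)) \<partial>M)" for j
    using cost_traj[OF us[of j]] cost_traj[OF u]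
    by (simp add: sum_subtractf diff_divide_distrib add_divide_distrib sum_divide_distrib)
  then show ?thesis by (simp only:) (intro tendsto_add tendsto_sum 1 2, simp_all)
qed

subsection \<open>The adjoint equation\<close>

lemma gradx_Ham_inner:
  assumes k: "k < N"
  shows "gradx_Ham ell b \<sigma> k x p q u \<bullet> h = blinfun_apply (Dl k (x, u)) (h, 0)
    + p \<bullet> blinfun_apply (Db k (x, u)) (h, 0) + (\<Sum>i\<in>UNIV. (q $ i) \<bullet> blinfun_apply (Ds k i (x, u)) (h, 0))"
  unfolding gradx_Ham_def Ham_def
  by (rule grad_inner, intro has_derivative_add has_derivative_sum has_derivative_inner_right)
    (rule has_derivative_fst_slice[where f="ell k", OF l_deriv[OF k]]
      has_derivative_fst_slice[where f="b k", OF b_deriv[OF k]]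
      has_derivative_fst_slice[where f="\<lambda>x u. \<sigma> k x u $ i" for i, OF s_deriv[OF k]])+

lemma gradu_Ham_inner:
  assumes k: "k < N"
  shows "gradu_Ham ell b \<sigma> k x p q u \<bullet> h = blinfun_apply (Dl k (x, u)) (0, h)
    + p \<bullet> blinfun_apply (Db k (x, u)) (0, h) + (\<Sum>i\<in>UNIV. (q $ i) \<bullet> blinfun_apply (Ds k i (x, u)) (0, h))"
  unfolding gradu_Ham_def Ham_def
  by (rule grad_inner, intro has_derivative_add has_derivative_sum has_derivative_inner_right)
    (rule has_derivative_snd_slice[where f="ell k", OF l_deriv[OF k]]
      has_derivative_snd_slice[where f="b k", OF b_deriv[OF k]]
      has_derivative_snd_slice[where f="\<lambda>x u. \<sigma> k x u $ i" for i, OF s_deriv[OF k]])+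

text \<open>Adding both gradients restores the joint derivatives at \<open>(h, v)\<close>, exactly
  the expressions that occur in the linearised dynamics and in the derivative of the cost.\<close>

lemma gradx_gradu_Ham_inner:
  assumes k: "k < N"
  shows "gradx_Ham ell b \<sigma> k x p q u \<bullet> h + gradu_Ham ell b \<sigma> k x p q u \<bullet> v
    = blinfun_apply (Dl k (x, u)) (h, v) + (p \<bullet> blinfun_apply (Db k (x, u)) (h, v)
      + (\<Sum>i\<in>UNIV. (q $ i) \<bullet> blinfun_apply (Ds k i (x, u)) (h, v)))"
proof -
  have *: "blinfun_apply A (h, v) = blinfun_apply A (h, 0) + blinfun_apply A (0, v)"
    for A :: "((real^'n) \<times> (real^'m)) \<Rightarrow>\<^sub>L 'z::real_normed_vector"
    by (simp add: blinfun.add_right[symmetric])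
  show ?thesis
    unfolding gradx_Ham_inner[OF k] gradu_Ham_inner[OF k] *[of "Dl k (x, u)"] *[of "Db k (x, u)"]
      *[of "Ds k _ (x, u)"]
    by (simp add: inner_add_right sum.distrib)
qed

lemma gradx_Ham_component:
  "k < N \<Longrightarrow> gradx_Ham ell b \<sigma> k x p q u $ j = blinfun_apply (Dl k (x, u)) (axis j 1, 0)
    + p \<bullet> blinfun_apply (Db k (x, u)) (axis j 1, 0)
    + (\<Sum>i\<in>UNIV. (q $ i) \<bullet> blinfun_apply (Ds k i (x, u)) (axis j 1, 0))"
  using gradx_Ham_inner[of k x p q u "axis j 1"] by (simp add: inner_axis)

lemma gradu_Ham_component:
  "k < N \<Longrightarrow> gradu_Ham ell b \<sigma> k x p q u $ j = blinfun_apply (Dl k (x, u)) (0, axis j 1)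
    + p \<bullet> blinfun_apply (Db k (x, u)) (0, axis j 1)
    + (\<Sum>i\<in>UNIV. (q $ i) \<bullet> blinfun_apply (Ds k i (x, u)) (0, axis j 1))"
  using gradu_Ham_inner[of k x p q u "axis j 1"] by (simp add: inner_axis)

text \<open>The derivatives of \<open>b\<close> and \<open>\<sigma>\<close> are bounded, so
  multiplying them by \<open>p\<close> and \<open>q\<close> stays in \<open>L2\<close>; the
  derivative of \<open>ell\<close> grows only linearly. Hence the backward recursion never leaves
  \<open>L2\<close>.\<close>

lemma
  assumes k: "k < N" and L2: "L2 M M x" "L2 M M p" "L2 M M q" "L2 M M u"
  shows gradx_Ham_L2: "L2 M M (\<lambda>\<omega>. gradx_Ham ell b \<sigma> k (x \<omega>) (p \<omega>) (q \<omega>) (u \<omega>))"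
    and gradu_Ham_L2: "L2 M M (\<lambda>\<omega>. gradu_Ham ell b \<sigma> k (x \<omega>) (p \<omega>) (q \<omega>) (u \<omega>))"
proof -
  note R = subalgebra_refl[of M]
  have Z: "L2 M M (\<lambda>\<omega>. (x \<omega>, u \<omega>))" by (rule L2_Pair) fact+
  \<comment> \<open>One estimate for an arbitrary increment \<open>h\<close> covers both gradients,
    whose components use increments supported in one of the two factors.\<close>
  have "L2 M M (\<lambda>\<omega>. blinfun_apply (Dl k (x \<omega>, u \<omega>)) h
    + p \<omega> \<bullet> blinfun_apply (Db k (x \<omega>, u \<omega>)) h
    + (\<Sum>i\<in>UNIV. (q \<omega> $ i) \<bullet> blinfun_apply (Ds k i (x \<omega>, u \<omega>)) h))" for h
    by (intro L2_add[OF R] L2_sum[OF R] L2_deriv_direction[OF fin Dl_cont[OF k] Dl_le[OF k] Z]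
          L2_inner_deriv[OF R Db_cont[OF k] Db_le[OF k] L2_measurable[OF Z]] L2
          L2_inner_deriv[OF R Ds_cont[OF k] Ds_le[OF k] L2_measurable[OF Z]] L2_vec_nth[OF R])
  then show "L2 M M (\<lambda>\<omega>. gradx_Ham ell b \<sigma> k (x \<omega>) (p \<omega>) (q \<omega>) (u \<omega>))"
    and "L2 M M (\<lambda>\<omega>. gradu_Ham ell b \<sigma> k (x \<omega>) (p \<omega>) (q \<omega>) (u \<omega>))"
    by (intro L2_vecI; simp only: gradx_Ham_component[OF k] gradu_Ham_component[OF k])+
qed

lemma grad_terminal_inner: "grad \<Phi> x \<bullet> h = blinfun_apply (DP x) h"
  by (rule grad_inner[OF P_deriv])

lemma grad_terminal_L2:
  assumes "L2 M M x"
  shows "L2 M M (\<lambda>\<omega>. grad \<Phi> (x \<omega>))"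
proof (rule L2_vecI)
  fix j
  have "grad \<Phi> y $ j = blinfun_apply (DP y) (axis j 1)" for y
    using grad_terminal_inner[of y "axis j 1"] by (simp add: inner_axis)
  then show "L2 M M (\<lambda>\<omega>. grad \<Phi> (x \<omega>) $ j)"
    using L2_deriv_direction[OF fin DP_cont DP_le assms] by simp
qed

text \<open>For centred noise with orthonormal coordinates, independent of the past, these are the
  coefficients of the orthogonal projection of \<open>G\<close> onto the state space
  \<open>Xsp\<close> of time \<open>k + 1\<close>. Hence the noise index is \<open>Suc k\<close>
  while the conditioning is on time \<open>k\<close>.\<close>

definition project :: "nat \<Rightarrow> ('a \<Rightarrow> real^'n) \<Rightarrow> ('a \<Rightarrow> real^'n) \<times> ('a \<Rightarrow> real^'n^'d)" where
  "project k G = (cond_exp_vec M (F k) G,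
     \<lambda>\<omega>. \<chi> i. cond_exp_vec M (F k) (\<lambda>\<omega>'. (w (Suc k) \<omega>' $ i) *\<^sub>R G \<omega>') \<omega>)"

text \<open>The adjoint recursion runs backwards: \<open>adjoint u j\<close> is the pair \<open>(p, q)\<close> at time \<open>N - 1 - j\<close>.\<close>
primrec adjoint :: "(nat \<Rightarrow> 'a \<Rightarrow> real^'m) \<Rightarrow> nat \<Rightarrow> ('a \<Rightarrow> real^'n) \<times> ('a \<Rightarrow> real^'n^'d)" where
  "adjoint u 0 = project (N - 1) (\<lambda>\<omega>. grad \<Phi> (traj u N \<omega>))"
| "adjoint u (Suc j) = project (N - 1 - Suc j) (\<lambda>\<omega>. gradx_Ham ell b \<sigma> (N - 1 - j)
     (traj u (N - 1 - j) \<omega>) (fst (adjoint u j) \<omega>) (snd (adjoint u j) \<omega>) (u (N - 1 - j) \<omega>))"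

definition padj where "padj u k = fst (adjoint u (N - 1 - k))"
definition qadj where "qadj u k = snd (adjoint u (N - 1 - k))"

text \<open>Placing the terminal gradient at index \<open>N\<close> merges the terminal conditions
  and the backward recursion into the single formula \<open>adjoint_step\<close>, and provides the
  quantity paired with \<open>lin\<close> in the telescoping sum.\<close>

definition Hx :: "(nat \<Rightarrow> 'a \<Rightarrow> real^'m) \<Rightarrow> nat \<Rightarrow> 'a \<Rightarrow> real^'n" where
  "Hx u k \<omega> = (if k = N then grad \<Phi> (traj u N \<omega>)
     else gradx_Ham ell b \<sigma> k (traj u k \<omega>) (padj u k \<omega>) (qadj u k \<omega>) (u k \<omega>))"

lemma adjoint_step:
  assumes "k < N"
  shows "padj u k = cond_exp_vec M (F k) (Hx u (Suc k))"
    and "qadj u k \<omega> $ i = cond_exp_vec M (F k) (\<lambda>\<omega>'. (w (Suc k) \<omega>' $ i) *\<^sub>R Hx u (Suc k) \<omega>') \<omega>"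
proof -
  have "adjoint u (N - 1 - k) = project k (Hx u (Suc k))"
  proof (cases "Suc k = N")
    case True
    then have "N - 1 - k = 0" "N - 1 = k" by auto
    with True show ?thesis by (simp add: Hx_def[abs_def])
  next
    case False
    \<comment> \<open>Away from the last time the reversed index \<open>N - 1 - k\<close> is a
      successor, which exposes the recursive clause; the facts that follow keep the truncated
      subtractions under control.\<close>
    define j where "j = N - 1 - Suc k"
    have j: "N - 1 - k = Suc j" "N - 1 - j = Suc k" "N - 1 - Suc j = k" "N - 1 - Suc k = j"
      using assms False by (auto simp: j_def)
    have "adjoint u (Suc j) = project k (Hx u (Suc k))"
      unfolding adjoint.simps j(2,3) using False j(4)
      by (simp add: Hx_def[abs_def] padj_def qadj_def)
    then show ?thesis unfolding j(1) .
  qed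
  then show "padj u k = cond_exp_vec M (F k) (Hx u (Suc k))"
    "qadj u k \<omega> $ i = cond_exp_vec M (F k) (\<lambda>\<omega>'. (w (Suc k) \<omega>' $ i) *\<^sub>R Hx u (Suc k) \<omega>') \<omega>"
    by (simp_all add: padj_def qadj_def project_def)
qed

lemma cond_space: "k \<le> N \<Longrightarrow> finite_measure_subalgebra M (F k)"
  using subalg_F by (intro finite_measure_subalgebra.intro finite_measure_subalgebra_axioms.intro fin) auto

lemma adjoint_L2_step:
  assumes k: "k < N" and G: "L2 M M (Hx u (Suc k))"
  shows "L2 M (F k) (padj u k)" "L2 M (F k) (qadj u k)"
proof -
  interpret S: finite_measure_subalgebra M "F k" using k by (intro cond_space) simp
  show "L2 M (F k) (padj u k)"
    using S.cond_exp_vec_L2[OF L2_multiplier_1[OF S.subalg] G] adjoint_step(1)[OF k] by simp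
  show "L2 M (F k) (qadj u k)"
    by (rule L2_vecI) (simp add: adjoint_step(2)[OF k] S.cond_exp_vec_L2[OF noise_multiplier[OF k] G])
qed

lemma traj_L2': "adm M w N u \<Longrightarrow> k \<le> N \<Longrightarrow> L2 M M (traj u k)"
  using L2_subalgebra[OF subalg_F traj_L2] by blast

lemma adm_L2': "adm M w N u \<Longrightarrow> k < N \<Longrightarrow> L2 M M (u k)"
  using L2_subalgebra[OF subalg_F[of k] adm_L2] by simp

text \<open>Induction downwards from \<open>N\<close>: \<open>L2\<close> membership at
  \<open>k + 1\<close> gives it for the adjoint pair at \<open>k\<close>, and hence for the
  Hamiltonian gradient at \<open>k\<close>.\<close>

lemma Hx_L2: 
  assumes u: "adm M w N u"
  shows "k \<le> N \<Longrightarrow> L2 M M (Hx u k)"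
proof (induction k rule: inc_induct)
  case base
  show ?case using grad_terminal_L2[OF traj_L2'[OF u order_refl]] by (simp add: Hx_def[abs_def])
next
  case (step k)
  note pq = adjoint_L2_step[OF step(2,3), THEN L2_subalgebra[OF subalg_F[OF less_imp_le[OF step(2)]]]]
  show ?case
    using gradx_Ham_L2[OF step(2) traj_L2'[OF u] pq adm_L2'[OF u step(2)]] step(2)
    by (simp add: Hx_def[abs_def])
qed

lemma adjoint_L2:
  assumes "adm M w N u" and k: "k < N"
  shows "L2 M (F k) (padj u k)" "L2 M (F k) (qadj u k)"
  using adjoint_L2_step[OF k Hx_L2] assms by auto

lemma integrable_gradu_inner:
  assumes u: "adm M w N u" and v: "adm M w N v" and k: "k < N"
  shows "integrable M (\<lambda>\<omega>. gradu_Ham ell b \<sigma> k (traj u k \<omega>) (padj u k \<omega>) (qadj u k \<omega>) (u k \<omega>) \<bullet> v k \<omega>)"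
proof -
  note S = L2_subalgebra[OF subalg_F[OF less_imp_le[OF k]]]
  note pq = adjoint_L2[OF u k, THEN S]
  show ?thesis
    by (rule integrable_inner_L2[OF gradu_Ham_L2[OF k traj_L2'[OF u less_imp_le[OF k]] pq adm_L2'[OF u k]]
          adm_L2'[OF v k]])
qed

text \<open>The linearised equation is inserted at time \<open>k + 1\<close> and its coefficients
  are paired with the adjoint. Those coefficients are known at time \<open>k\<close>, so
  conditioning is free, and the Hamiltonian identity sorts the result into state, control and
  running cost parts.\<close>

lemma adjoint_duality_step:
  assumes u: "adm M w N u" and v: "adm M w N v" and k: "k < N"
  shows "(\<integral>\<omega>. Hx u (Suc k) \<omega> \<bullet> lin u v (Suc k) \<omega> \<partial>M) - (\<integral>\<omega>. Hx u k \<omega> \<bullet> lin u v k \<omega> \<partial>M)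
    = (\<integral>\<omega>. gradu_Ham ell b \<sigma> k (traj u k \<omega>) (padj u k \<omega>) (qadj u k \<omega>) (u k \<omega>) \<bullet> v k \<omega> \<partial>M)
     - (\<integral>\<omega>. blinfun_apply (Dl k (traj u k \<omega>, u k \<omega>)) (lin u v k \<omega>, v k \<omega>) \<partial>M)"
proof -
  interpret S: finite_measure_subalgebra M "F k" using k by (intro cond_space) simp
  note S = L2_subalgebra[OF S.subalg] and S' = L2_subalgebra[OF subalg_F[OF Suc_leI[OF k]]]
  let ?G = "Hx u (Suc k)"
  let ?Z = "\<lambda>\<omega>. (traj u k \<omega>, u k \<omega>)" and ?Y = "\<lambda>\<omega>. (lin u v k \<omega>, v k \<omega>)"
  let ?b = "\<lambda>\<omega>. blinfun_apply (Db k (?Z \<omega>)) (?Y \<omega>)"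
  let ?s = "\<lambda>i \<omega>. blinfun_apply (Ds k i (?Z \<omega>)) (?Y \<omega>)"
  let ?l = "\<lambda>\<omega>. blinfun_apply (Dl k (?Z \<omega>)) (?Y \<omega>)"
  let ?gu = "\<lambda>\<omega>. gradu_Ham ell b \<sigma> k (traj u k \<omega>) (padj u k \<omega>) (qadj u k \<omega>) (u k \<omega>)"
  have G: "L2 M M ?G" using k by (intro Hx_L2 u) simp
  have lin: "L2 M (F k) (lin u v k)" using k by (intro lin_L2 u v) simp
  have Z: "L2 M (F k) ?Z" using k by (intro L2_Pair traj_L2 adm_L2 u) auto
  have Y: "L2 M (F k) ?Y" using k by (intro L2_Pair lin adm_L2 v) auto
  have bL2: "L2 M (F k) ?b"
    by (rule L2_deriv_apply[OF S.subalg Db_cont[OF k] Db_le[OF k] L2_measurable[OF Z] Y])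
  have sL2: "L2 M (F k) (?s i)" for i
    by (rule L2_deriv_apply[OF S.subalg Ds_cont[OF k] Ds_le[OF k] L2_measurable[OF Z] Y])
  note pq = adjoint_L2[OF u k]
  have q: "L2 M (F k) (\<lambda>\<omega>. qadj u k \<omega> $ i)" for i by (rule L2_vec_nth[OF S.subalg pq(2)])
  have ws: "L2 M M (\<lambda>\<omega>. (w (Suc k) \<omega> $ i) *\<^sub>R ?s i \<omega>)" for i
    by (rule S'[OF noise_L2[OF k sL2]])
  have intl: "integrable M ?l"
    by (rule integrable_deriv_apply[OF fin Dl_cont[OF k] Dl_le[OF k] S[OF Z] S[OF Y]])
  note intu = integrable_gradu_inner[OF u v k]
  have intx: "integrable M (\<lambda>\<omega>. Hx u k \<omega> \<bullet> lin u v k \<omega>)"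
    using k by (intro integrable_inner_L2 Hx_L2 u S[OF lin]) auto
  note intp = integrable_inner_L2[OF S[OF pq(1)] S[OF bL2]]
  note intq = integrable_inner_L2[OF S[OF q] S[OF sL2]]
  have 1: "(\<integral>\<omega>. ?G \<omega> \<bullet> lin u v (Suc k) \<omega> \<partial>M)
      = (\<integral>\<omega>. ?G \<omega> \<bullet> ?b \<omega> + (\<Sum>i\<in>UNIV. ?G \<omega> \<bullet> ((w (Suc k) \<omega> $ i) *\<^sub>R ?s i \<omega>)) \<partial>M)"
    by (simp add: inner_add_right inner_sum_right)
  have 2: "(\<integral>\<omega>. ?G \<omega> \<bullet> ?b \<omega> + (\<Sum>i\<in>UNIV. ?G \<omega> \<bullet> ((w (Suc k) \<omega> $ i) *\<^sub>R ?s i \<omega>)) \<partial>M) = (\<integral>\<omega>. ?G \<omega> \<bullet> ?b \<omega> \<partial>M) + (\<Sum>i\<in>UNIV. \<integral>\<omega>. ?G \<omega> \<bullet> ((w (Suc k) \<omega> $ i) *\<^sub>R ?s i \<omega>) \<partial>M)"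
    using integrable_inner_L2[OF G S[OF bL2]] integrable_inner_L2[OF G ws]
    by (subst Bochner_Integration.integral_add)
      (auto intro!: Bochner_Integration.integrable_sum simp del: inner_scaleR_right simp: Bochner_Integration.integral_sum)
  \<comment> \<open>The partner is measurable at time \<open>k\<close>, so \<open>Hx\<close> at
    \<open>k + 1\<close> may be replaced by its conditional expectation.\<close>
  have 3: "(\<integral>\<omega>. ?G \<omega> \<bullet> ?b \<omega> \<partial>M) = (\<integral>\<omega>. padj u k \<omega> \<bullet> ?b \<omega> \<partial>M)"
    using S.integral_cond_exp_vec[OF L2_multiplier_1[OF S.subalg] G bL2]
    by (simp add: adjoint_step(1)[OF k])
  \<comment> \<open>The noise coordinate moves from the linearised diffusion onto the gradient
    before conditioning; this is what \<open>qadj\<close> records.\<close>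
  have 4: "(\<Sum>i\<in>UNIV. \<integral>\<omega>. ?G \<omega> \<bullet> ((w (Suc k) \<omega> $ i) *\<^sub>R ?s i \<omega>) \<partial>M)
      = (\<Sum>i\<in>UNIV. \<integral>\<omega>. (qadj u k \<omega> $ i) \<bullet> ?s i \<omega> \<partial>M)"
    unfolding adjoint_step(2)[OF k]
    by (intro sum.cong refl S.integral_cond_exp_vec[OF noise_multiplier[OF k] G sL2, symmetric])
  have 5: "(\<integral>\<omega>. padj u k \<omega> \<bullet> ?b \<omega> \<partial>M) + (\<Sum>i\<in>UNIV. \<integral>\<omega>. (qadj u k \<omega> $ i) \<bullet> ?s i \<omega> \<partial>M)
      = (\<integral>\<omega>. padj u k \<omega> \<bullet> ?b \<omega> + (\<Sum>i\<in>UNIV. (qadj u k \<omega> $ i) \<bullet> ?s i \<omega>) \<partial>M)"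
    using intp intq by (subst Bochner_Integration.integral_add)
      (auto intro!: Bochner_Integration.integrable_sum simp: Bochner_Integration.integral_sum)
  have 6: "(\<integral>\<omega>. padj u k \<omega> \<bullet> ?b \<omega> + (\<Sum>i\<in>UNIV. (qadj u k \<omega> $ i) \<bullet> ?s i \<omega>) \<partial>M)
      = (\<integral>\<omega>. Hx u k \<omega> \<bullet> lin u v k \<omega> + ?gu \<omega> \<bullet> v k \<omega> - ?l \<omega> \<partial>M)"
    using gradx_gradu_Ham_inner[OF k] k by (simp add: Hx_def)
  have 7: "(\<integral>\<omega>. Hx u k \<omega> \<bullet> lin u v k \<omega> + ?gu \<omega> \<bullet> v k \<omega> - ?l \<omega> \<partial>M) = (\<integral>\<omega>. Hx u k \<omega> \<bullet> lin u v k \<omega> \<partial>M) + (\<integral>\<omega>. ?gu \<omega> \<bullet> v k \<omega> \<partial>M) - (\<integral>\<omega>. ?l \<omega> \<partial>M)"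
    using intl intu intx by simp
  show ?thesis using 1 2 3 4 5 6 7 by linarith
qed

text \<open>The pairing of \<open>Hx\<close> with \<open>lin\<close> telescopes in time: it vanishes
  at 0 because \<open>lin\<close> starts at 0, and at \<open>N\<close> it is the derivative of the
  terminal cost. The running cost terms cancel, leaving only the control gradients.\<close>

lemma adjoint_duality:
  assumes u: "adm M w N u" and v: "adm M w N v"
  shows "(\<Sum>k<N. \<integral>\<omega>. blinfun_apply (Dl k (traj u k \<omega>, u k \<omega>)) (lin u v k \<omega>, v k \<omega>) \<partial>M)
        + (\<integral>\<omega>. blinfun_apply (DP (traj u N \<omega>)) (lin u v N \<omega>) \<partial>M)
    = (\<integral>\<omega>. (\<Sum>k<N. gradu_Ham ell b \<sigma> k (traj u k \<omega>) (padj u k \<omega>) (qadj u k \<omega>) (u k \<omega>) \<bullet> v k \<omega>) \<partial>M)"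
proof -
  let ?a = "\<lambda>k. \<integral>\<omega>. Hx u k \<omega> \<bullet> lin u v k \<omega> \<partial>M"
  let ?gu = "\<lambda>k \<omega>. gradu_Ham ell b \<sigma> k (traj u k \<omega>) (padj u k \<omega>) (qadj u k \<omega>) (u k \<omega>)"
  have "(\<integral>\<omega>. blinfun_apply (DP (traj u N \<omega>)) (lin u v N \<omega>) \<partial>M) = ?a N - ?a 0"
    by (simp add: Hx_def grad_terminal_inner)
  also have "\<dots> = (\<Sum>k<N. ?a (Suc k) - ?a k)" by (rule sum_lessThan_telescope[symmetric])
  also have "\<dots> = (\<Sum>k<N. (\<integral>\<omega>. ?gu k \<omega> \<bullet> v k \<omega> \<partial>M)
      - (\<integral>\<omega>. blinfun_apply (Dl k (traj u k \<omega>, u k \<omega>)) (lin u v k \<omega>, v k \<omega>) \<partial>M))"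
    by (intro sum.cong refl adjoint_duality_step u v) simp
  finally show ?thesis
    using integrable_gradu_inner[OF u v] by (simp add: sum_subtractf Bochner_Integration.integral_sum)
qed

subsection \<open>First order conditions\<close>

lemma feasible_traj:
  assumes U: "ctrl_set M w N U" and u: "u \<in> U"
  shows "feasible M w N b \<sigma> x0 U (traj u) u"
proof -
  have adm: "adm M w N u" by (rule ctrl_set_adm[OF U u])
  have "traj u k \<in> Xsp M w k" if k: "k \<le> N" for k
  proof (cases k)
    case 0
    then show ?thesis by (simp add: Xsp_def)
  next
    case (Suc l)
    then have l: "l < N" using k by simp
    have L: "L2 M (F l) (\<lambda>\<omega>. b l (traj u l \<omega>) (u l \<omega>))" "\<And>i. L2 M (F l) (\<lambda>\<omega>. \<sigma> l (traj u l \<omega>) (u l \<omega>) $ i)"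
      using l by (intro coeff_L2 traj_L2 adm_L2 adm; simp)+
    have "traj u (Suc l) \<in> borel_measurable M" using traj_L2'[OF adm k] Suc by (simp add: L2_def)
    with L show ?thesis unfolding Suc Xsp_def
      \<comment> \<open>The drift and the diffusion columns of the last step are the required
        coefficients, measurable one time earlier.\<close>
      by (auto intro!: exI[of _ "\<lambda>\<omega>. b l (traj u l \<omega>) (u l \<omega>)"] exI[of _ "\<lambda>i \<omega>. \<sigma> l (traj u l \<omega>) (u l \<omega>) $ i"])
  qed
  then show ?thesis using u by (simp add: feasible_def)
qed

lemma feasible_AE_traj:
  assumes "feasible M w N b \<sigma> x0 U x u"
  shows "k \<le> N \<Longrightarrow> AE \<omega> in M. x k \<omega> = traj u k \<omega>"
proof (induction k)
  case 0
  then show ?case using assms by (simp add: feasible_def)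
next
  case (Suc k)
  have "AE \<omega> in M. x (Suc k) \<omega> =
          b k (x k \<omega>) (u k \<omega>) + (\<Sum>i\<in>UNIV. (w (Suc k) \<omega> $ i) *\<^sub>R (\<sigma> k (x k \<omega>) (u k \<omega>) $ i))"
    using assms Suc.prems by (auto simp: feasible_def)
  moreover have "AE \<omega> in M. x k \<omega> = traj u k \<omega>" using Suc by simp
  ultimately show ?case by eventually_elim simp
qed

text \<open>Both the perturbed controls and their trajectories return to the base pair, so
  eventually they compete in the neighbourhood and the cost quotients are nonnegative. Their limit
  is the adjoint expression.\<close>

lemma first_order_condition:
  assumes U: "ctrl_set M w N U" and u: "u \<in> U" and r: "r > 0"
    and min: "\<And>u'. u' \<in> U \<Longrightarrow> (\<Sum>k\<le>N. L2norm M (\<lambda>\<omega>. traj u' k \<omega> - traj u k \<omega>)) + cdist M N u' u < r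
        \<Longrightarrow> cost M N ell \<Phi> (traj u) u \<le> cost M N ell \<Phi> (traj u') u'"
    and v: "adm M w N v"
    and approx: "\<And>e. e > 0 \<Longrightarrow> \<exists>t. 0 < t \<and> t < e \<and> distU M N U (addc u t v) / t < e"
  shows "0 \<le> (\<integral>\<omega>. (\<Sum>k<N. gradu_Ham ell b \<sigma> k (traj u k \<omega>) (padj u k \<omega>) (qadj u k \<omega>) (u k \<omega>) \<bullet> v k \<omega>) \<partial>M)"
proof -
  have adm: "adm M w N u" by (rule ctrl_set_adm[OF U u])
  obtain t vs where t: "t \<longlonglongrightarrow> 0" "\<And>j. t j > 0" "\<And>j. t j \<le> 1" and vsU: "\<And>j. addc u (t j) (vs j) \<in> U"
    and vs: "\<And>k. k < N \<Longrightarrow> L2_tendsto M (F k) (\<lambda>j. vs j k) (v k)"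
    using approximating_controls[OF subalg_F[OF less_imp_le] U u v approx] by blast
  let ?u = "\<lambda>j. addc u (t j) (vs j)"
  have admj: "adm M w N (?u j)" for j by (rule ctrl_set_adm[OF U vsU])
  \<comment> \<open>The state deviation is \<open>t j\<close> times a convergent, hence
    \<open>L2\<close> bounded, quotient.\<close>
  have x: "(\<lambda>j. L2norm M (\<lambda>\<omega>. traj (?u j) k \<omega> - traj u k \<omega>)) \<longlonglongrightarrow> 0" if k: "k \<le> N" for k
    using L2norm_scaled_tendsto_0[OF subalg_F[OF k] traj_tendsto[OF adm vs t(1,2) k] t(1)]
    using t(2) by (simp add: less_imp_neq[symmetric])
  have ctl: "(\<lambda>j. L2norm M (\<lambda>\<omega>. ?u j k \<omega> - u k \<omega>)) \<longlonglongrightarrow> 0" if k: "k < N" for k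
    using L2norm_scaled_tendsto_0[OF subalg_F[OF less_imp_le[OF k]] vs[OF k] t(1)] by (simp add: addc_def)
  have "(\<lambda>j. (\<Sum>k\<le>N. L2norm M (\<lambda>\<omega>. traj (?u j) k \<omega> - traj u k \<omega>)) + cdist M N (?u j) u)
      \<longlonglongrightarrow> (\<Sum>k\<le>N. 0) + (\<Sum>k<N. 0)"
    unfolding cdist_def by (intro tendsto_add tendsto_sum x ctl) auto
  then have "\<forall>\<^sub>F j in sequentially. (\<Sum>k\<le>N. L2norm M (\<lambda>\<omega>. traj (?u j) k \<omega> - traj u k \<omega>)) + cdist M N (?u j) u < r"
    using r by (intro order_tendstoD) auto
  then have "\<forall>\<^sub>F j in sequentially.
      0 \<le> (1 / t j) * (cost M N ell \<Phi> (traj (?u j)) (?u j) - cost M N ell \<Phi> (traj u) u)"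
    by eventually_elim (use min[OF vsU] t(2) in \<open>simp add: less_imp_le\<close>)
  then show ?thesis
    unfolding adjoint_duality[OF adm v, symmetric]
    by (intro tendsto_lowerbound[OF cost_tendsto[OF adm admj vs t]]) auto
qed

text \<open>What remains is to pass from \<open>traj ub\<close> to the given state
  \<open>xb\<close>, which agree almost everywhere at each of the finitely many times. Costs,
  distances, conditional expectations and the final integral are all insensitive to this
  change.\<close>

lemma maximum_principle:
  assumes N: "N \<ge> 1" and U: "ctrl_set M w N U"
    and loc: "local_solution M w N b \<sigma> ell \<Phi> x0 U xb ub"
  shows "\<exists>p :: nat \<Rightarrow> 'a \<Rightarrow> real^'n. \<exists>q :: nat \<Rightarrow> 'a \<Rightarrow> real^'n^'d.
     (\<forall>k<N. L2 M (F k) (p k) \<and> L2 M (F k) (q k)) \<and>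
     (\<forall>k\<in>{1..N-1}.
        (AE \<omega> in M. p (k-1) \<omega> = cond_exp_vec M (F (k-1))
            (\<lambda>\<omega>'. gradx_Ham ell b \<sigma> k (xb k \<omega>') (p k \<omega>') (q k \<omega>') (ub k \<omega>')) \<omega>) \<and>
        (\<forall>i. AE \<omega> in M. q (k-1) \<omega> $ i = cond_exp_vec M (F (k-1))
            (\<lambda>\<omega>'. (w k \<omega>' $ i) *\<^sub>R gradx_Ham ell b \<sigma> k (xb k \<omega>') (p k \<omega>') (q k \<omega>') (ub k \<omega>')) \<omega>)) \<and>
     (AE \<omega> in M. p (N-1) \<omega> = cond_exp_vec M (F (N-1)) (\<lambda>\<omega>'. grad \<Phi> (xb N \<omega>')) \<omega>) \<and>
     (\<forall>i. AE \<omega> in M. q (N-1) \<omega> $ i = cond_exp_vec M (F (N-1))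
            (\<lambda>\<omega>'. (w N \<omega>' $ i) *\<^sub>R grad \<Phi> (xb N \<omega>')) \<omega>) \<and>
     (\<forall>v\<in>clarke_cone M w N U ub.
        (\<integral>\<omega>. (\<Sum>k<N. gradu_Ham ell b \<sigma> k (xb k \<omega>) (p k \<omega>) (q k \<omega>) (ub k \<omega>) \<bullet> v k \<omega>) \<partial>M) \<ge> 0) \<and>
     (\<forall>v\<in>contingent_cone M w N U ub.
        (\<integral>\<omega>. (\<Sum>k<N. gradu_Ham ell b \<sigma> k (xb k \<omega>) (p k \<omega>) (q k \<omega>) (ub k \<omega>) \<bullet> v k \<omega>) \<partial>M) \<ge> 0)"
proof -
  from loc have feas: "feasible M w N b \<sigma> x0 U xb ub" by (simp add: local_solution_def)
  then have ubU: "ub \<in> U" and xbX: "\<And>k. k \<le> N \<Longrightarrow> xb k \<in> borel_measurable M"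
    by (auto simp: feasible_def Xsp_def)
  have adm: "adm M w N ub" by (rule ctrl_set_adm[OF U ubU])
  note ae = feasible_AE_traj[OF feas]
  have xbL2: "L2 M M (xb k)" if "k \<le> N" for k
    by (rule L2_cong_AE[OF traj_L2'[OF adm that] ae[OF that] xbX[OF that]])
  have aeN: "AE \<omega> in M. \<forall>k\<in>{..N}. xb k \<omega> = traj ub k \<omega>"
    using ae by (subst AE_ball_countable) auto
  define p where "p = padj ub"
  define q where "q = qadj ub"
  have pqF: "L2 M (F k) (p k)" "L2 M (F k) (q k)" if "k < N" for k
    unfolding p_def q_def by (rule adjoint_L2[OF adm that])+
  have pq: "L2 M M (p k)" "L2 M M (q k)" if "k < N" for k
    using pqF[OF that] that by (auto intro: L2_subalgebra[OF subalg_F[of k]])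
  \<comment> \<open>Stated for any \<open>G\<close> that agrees almost everywhere with
    \<open>Hx\<close>, so that it serves the recursion as well as the terminal condition.\<close>
  have step: "(AE \<omega> in M. p k \<omega> = cond_exp_vec M (F k) G \<omega>) \<and>
     (\<forall>i. AE \<omega> in M. q k \<omega> $ i = cond_exp_vec M (F k) (\<lambda>\<omega>'. (w (Suc k) \<omega>' $ i) *\<^sub>R G \<omega>') \<omega>)"
    if k: "k < N" and G: "L2 M M G" and eq: "AE \<omega> in M. Hx ub (Suc k) \<omega> = G \<omega>" for k G
  proof (intro conjI allI)
    have sf: "sigma_finite_subalgebra M (F k)"
      using k by (intro finite_measure_subalgebra_is_sigma_finite cond_space) simp
    have H: "L2 M M (Hx ub (Suc k))" using k by (intro Hx_L2 adm) simp
    show "AE \<omega> in M. p k \<omega> = cond_exp_vec M (F k) G \<omega>"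
      unfolding p_def adjoint_step(1)[OF k]
      by (rule cond_exp_vec_cong_AE[OF sf L2_measurable[OF H] L2_measurable[OF G] eq])
    fix i
    have W: "(\<lambda>\<omega>. w (Suc k) \<omega> $ i) \<in> borel_measurable M"
      using noise_multiplier[OF k] by (simp add: L2_multiplier_def)
    show "AE \<omega> in M. q k \<omega> $ i = cond_exp_vec M (F k) (\<lambda>\<omega>'. (w (Suc k) \<omega>' $ i) *\<^sub>R G \<omega>') \<omega>"
      unfolding q_def adjoint_step(2)[OF k]
      by (rule cond_exp_vec_cong_AE[OF sf borel_measurable_scaleR[OF W L2_measurable[OF H]]
            borel_measurable_scaleR[OF W L2_measurable[OF G]]]) (use eq in auto)
  qed
  have interior: "(AE \<omega> in M. p (k-1) \<omega> = cond_exp_vec M (F (k-1))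
            (\<lambda>\<omega>'. gradx_Ham ell b \<sigma> k (xb k \<omega>') (p k \<omega>') (q k \<omega>') (ub k \<omega>')) \<omega>) \<and>
        (\<forall>i. AE \<omega> in M. q (k-1) \<omega> $ i = cond_exp_vec M (F (k-1))
            (\<lambda>\<omega>'. (w k \<omega>' $ i) *\<^sub>R gradx_Ham ell b \<sigma> k (xb k \<omega>') (p k \<omega>') (q k \<omega>') (ub k \<omega>')) \<omega>)"
    if "k \<in> {1..N-1}" for k
  proof -
    from that N have k: "k < N" "Suc (k - 1) = k" "k - 1 < N" by auto
    have "AE \<omega> in M. Hx ub (Suc (k - 1)) \<omega> = gradx_Ham ell b \<sigma> k (xb k \<omega>) (p k \<omega>) (q k \<omega>) (ub k \<omega>)"
      unfolding k(2) using ae[OF less_imp_le[OF k(1)]] by eventually_elim (use k(1) in \<open>simp add: Hx_def p_def q_def\<close>)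
    from step[OF k(3) gradx_Ham_L2[OF k(1) xbL2 pq adm_L2'[OF adm]] this] k show ?thesis by simp
  qed
  have terminal: "(AE \<omega> in M. p (N-1) \<omega> = cond_exp_vec M (F (N-1)) (\<lambda>\<omega>'. grad \<Phi> (xb N \<omega>')) \<omega>) \<and>
     (\<forall>i. AE \<omega> in M. q (N-1) \<omega> $ i = cond_exp_vec M (F (N-1))
            (\<lambda>\<omega>'. (w N \<omega>' $ i) *\<^sub>R grad \<Phi> (xb N \<omega>')) \<omega>)"
  proof -
    from N have k: "N - 1 < N" "Suc (N - 1) = N" by auto
    have "AE \<omega> in M. Hx ub (Suc (N - 1)) \<omega> = grad \<Phi> (xb N \<omega>)"
      unfolding k(2) using ae[OF order_refl] by eventually_elim (simp add: Hx_def)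
    from step[OF k(1) grad_terminal_L2[OF xbL2[OF order_refl]] this] k show ?thesis by simp
  qed
  have ineq: "0 \<le> (\<integral>\<omega>. (\<Sum>k<N. gradu_Ham ell b \<sigma> k (xb k \<omega>) (p k \<omega>) (q k \<omega>) (ub k \<omega>) \<bullet> v k \<omega>) \<partial>M)"
    if v: "v \<in> clarke_cone M w N U ub \<union> contingent_cone M w N U ub" for v
  proof -
    have admv: "adm M w N v" using v by (auto simp: clarke_cone_def contingent_cone_def)
    have approx: "\<exists>t. 0 < t \<and> t < e \<and> distU M N U (addc ub t v) / t < e" if "e > 0" for e
      using v clarke_cone_approx[OF _ ubU that] contingent_cone_approx[OF _ that] by blast
    obtain r where r: "r > 0" "\<And>x u. feasible M w N b \<sigma> x0 U x u \<Longrightarrow>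
        (\<Sum>k\<le>N. L2norm M (\<lambda>\<omega>. x k \<omega> - xb k \<omega>)) + cdist M N u ub < r \<Longrightarrow>
        cost M N ell \<Phi> xb ub \<le> cost M N ell \<Phi> x u"
      using loc unfolding local_solution_def by blast
    have cost_eq: "cost M N ell \<Phi> xb ub = cost M N ell \<Phi> (traj ub) ub"
      unfolding cost_def
    proof (rule integral_cong_AE)
      have meas: "(\<lambda>\<omega>. (\<Sum>k<N. ell k (x k \<omega>) (ub k \<omega>)) + \<Phi> (x N \<omega>)) \<in> borel_measurable M"
        if x: "\<And>k. k \<le> N \<Longrightarrow> x k \<in> borel_measurable M" for x
      proof (intro borel_measurable_add borel_measurable_sum)
        show "(\<lambda>\<omega>. \<Phi> (x N \<omega>)) \<in> borel_measurable M"
          by (rule borel_measurable_C1_comp[OF P_deriv x]) simp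
        fix k assume "k \<in> {..<N}"
        then have k: "k < N" by simp
        have "(\<lambda>\<omega>. (x k \<omega>, ub k \<omega>)) \<in> borel_measurable M"
          by (intro borel_measurable_Pair x L2_measurable[OF adm_L2'[OF adm k]]) (use k in simp)
        from borel_measurable_C1_comp[OF l_deriv[OF k] this]
        show "(\<lambda>\<omega>. ell k (x k \<omega>) (ub k \<omega>)) \<in> borel_measurable M" by simp
      qed
      show "(\<lambda>\<omega>. (\<Sum>k<N. ell k (xb k \<omega>) (ub k \<omega>)) + \<Phi> (xb N \<omega>)) \<in> borel_measurable M"
        by (rule meas[OF xbX])
      show "(\<lambda>\<omega>. (\<Sum>k<N. ell k (traj ub k \<omega>) (ub k \<omega>)) + \<Phi> (traj ub N \<omega>)) \<in> borel_measurable M"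
        by (rule meas[OF L2_measurable[OF traj_L2'[OF adm]]])
      show "AE \<omega> in M. (\<Sum>k<N. ell k (xb k \<omega>) (ub k \<omega>)) + \<Phi> (xb N \<omega>)
          = (\<Sum>k<N. ell k (traj ub k \<omega>) (ub k \<omega>)) + \<Phi> (traj ub N \<omega>)"
        using aeN by eventually_elim simp
    qed
    \<comment> \<open>The neighbourhood of local optimality is measured from \<open>xb\<close>,
      whereas the first order condition measures from \<open>traj ub\<close>; the two distances
      coincide.\<close>
    have dist_eq: "L2norm M (\<lambda>\<omega>. x \<omega> - xb k \<omega>) = L2norm M (\<lambda>\<omega>. x \<omega> - traj ub k \<omega>)"
      if k: "k \<le> N" and [measurable]: "x \<in> borel_measurable M" for x k
    proof -
      have [measurable]: "xb k \<in> borel_measurable M" "traj ub k \<in> borel_measurable M"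
        using xbX[OF k] L2_measurable[OF traj_L2'[OF adm k]] by auto
      have "(\<integral>\<omega>. (norm (x \<omega> - xb k \<omega>))\<^sup>2 \<partial>M) = (\<integral>\<omega>. (norm (x \<omega> - traj ub k \<omega>))\<^sup>2 \<partial>M)"
        by (rule integral_cong_AE) (use ae[OF k] in auto)
      then show ?thesis by (simp add: L2norm_def)
    qed
    have "0 \<le> (\<integral>\<omega>. (\<Sum>k<N. gradu_Ham ell b \<sigma> k (traj ub k \<omega>) (p k \<omega>) (q k \<omega>) (ub k \<omega>) \<bullet> v k \<omega>) \<partial>M)"
      unfolding p_def q_def
    proof (rule first_order_condition[OF U ubU r(1) _ admv approx])
      fix u' assume u': "u' \<in> U"
        and lt: "(\<Sum>k\<le>N. L2norm M (\<lambda>\<omega>. traj u' k \<omega> - traj ub k \<omega>)) + cdist M N u' ub < r"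
      have admu': "adm M w N u'" by (rule ctrl_set_adm[OF U u'])
      have "(\<Sum>k\<le>N. L2norm M (\<lambda>\<omega>. traj u' k \<omega> - xb k \<omega>))
          = (\<Sum>k\<le>N. L2norm M (\<lambda>\<omega>. traj u' k \<omega> - traj ub k \<omega>))"
        by (intro sum.cong refl dist_eq L2_measurable[OF traj_L2'[OF admu']]) auto
      with r(2)[OF feasible_traj[OF U u']] lt show "cost M N ell \<Phi> (traj ub) ub \<le> cost M N ell \<Phi> (traj u') u'"
        by (simp add: cost_eq)
    qed
    also have "\<dots> = (\<integral>\<omega>. (\<Sum>k<N. gradu_Ham ell b \<sigma> k (xb k \<omega>) (p k \<omega>) (q k \<omega>) (ub k \<omega>) \<bullet> v k \<omega>) \<partial>M)"
    proof (rule integral_cong_AE)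
      have meas: "(\<lambda>\<omega>. (\<Sum>k<N. gradu_Ham ell b \<sigma> k (x k \<omega>) (p k \<omega>) (q k \<omega>) (ub k \<omega>) \<bullet> v k \<omega>)) \<in> borel_measurable M"
        if x: "\<And>k. k \<le> N \<Longrightarrow> L2 M M (x k)" for x
      proof (rule borel_measurable_sum)
        fix k assume "k \<in> {..<N}"
        then have k: "k < N" by simp
        show "(\<lambda>\<omega>. gradu_Ham ell b \<sigma> k (x k \<omega>) (p k \<omega>) (q k \<omega>) (ub k \<omega>) \<bullet> v k \<omega>) \<in> borel_measurable M"
          by (rule borel_measurable_inner[OF L2_measurable[OF gradu_Ham_L2[OF k x[OF less_imp_le[OF k]] pq[OF k]
                  adm_L2'[OF adm k]]] L2_measurable[OF adm_L2'[OF admv k]]])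
      qed
      show "(\<lambda>\<omega>. (\<Sum>k<N. gradu_Ham ell b \<sigma> k (xb k \<omega>) (p k \<omega>) (q k \<omega>) (ub k \<omega>) \<bullet> v k \<omega>)) \<in> borel_measurable M"
        by (rule meas[OF xbL2])
      show "(\<lambda>\<omega>. (\<Sum>k<N. gradu_Ham ell b \<sigma> k (traj ub k \<omega>) (p k \<omega>) (q k \<omega>) (ub k \<omega>) \<bullet> v k \<omega>)) \<in> borel_measurable M"
        by (rule meas[OF traj_L2'[OF adm]])
      show "AE \<omega> in M. (\<Sum>k<N. gradu_Ham ell b \<sigma> k (traj ub k \<omega>) (p k \<omega>) (q k \<omega>) (ub k \<omega>) \<bullet> v k \<omega>)
        = (\<Sum>k<N. gradu_Ham ell b \<sigma> k (xb k \<omega>) (p k \<omega>) (q k \<omega>) (ub k \<omega>) \<bullet> v k \<omega>)"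
        using aeN by eventually_elim simp
    qed
    finally show ?thesis .
  qed
  show ?thesis
    by (intro exI[of _ p] exI[of _ q] conjI allI impI ballI pqF interior[THEN conjunct1]
        interior[THEN conjunct2, rule_format] terminal[THEN conjunct1]
        terminal[THEN conjunct2, rule_format]) (auto intro: ineq)
qed

end

theorem theorem6p4:
  fixes M :: "'a measure"
    and w :: "nat \<Rightarrow> 'a \<Rightarrow> real^'d::finite"
    and N :: nat
    and x0 :: "real^'n::finite"
    and b :: "nat \<Rightarrow> real^'n \<Rightarrow> real^'m::finite \<Rightarrow> real^'n"
    and \<sigma> :: "nat \<Rightarrow> real^'n \<Rightarrow> real^'m \<Rightarrow> real^'n^'d"
    and ell :: "nat \<Rightarrow> real^'n \<Rightarrow> real^'m \<Rightarrow> real"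
    and \<Phi> :: "real^'n \<Rightarrow> real"
    and U :: "(nat \<Rightarrow> 'a \<Rightarrow> real^'m) set"
    and xb :: "nat \<Rightarrow> 'a \<Rightarrow> real^'n"
    and ub :: "nat \<Rightarrow> 'a \<Rightarrow> real^'m"
  assumes P: "prob_space M"
    and N: "N \<ge> 1"
    and w_indep: "prob_space.indep_vars M (\<lambda>_. borel) w {1..N}"
    and w_coord_indep: "\<forall>k\<in>{1..N}. prob_space.indep_vars M (\<lambda>_. borel) (\<lambda>i \<omega>. w k \<omega> $ i) UNIV"
    and w_mean: "\<forall>k\<in>{1..N}. \<forall>i. integrable M (\<lambda>\<omega>. w k \<omega> $ i) \<and> (\<integral>\<omega>. w k \<omega> $ i \<partial>M) = 0"
    and w_var: "\<forall>k\<in>{1..N}. \<forall>i. integrable M (\<lambda>\<omega>. (w k \<omega> $ i)\<^sup>2) \<and> (\<integral>\<omega>. (w k \<omega> $ i)\<^sup>2 \<partial>M) = 1"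
    and b_meas: "\<forall>k<N. (\<lambda>z. b k (fst z) (snd z)) \<in> borel_measurable borel"
    and \<sigma>_meas: "\<forall>k<N. \<forall>i. (\<lambda>z. \<sigma> k (fst z) (snd z) $ i) \<in> borel_measurable borel"
    and ell_meas: "\<forall>k<N. (\<lambda>z. ell k (fst z) (snd z)) \<in> borel_measurable borel"
    and \<Phi>_meas: "\<Phi> \<in> borel_measurable borel"
    and b_C1: "\<forall>k<N. C1_map (\<lambda>z. b k (fst z) (snd z))"
    and \<sigma>_C1: "\<forall>k<N. \<forall>i. C1_map (\<lambda>z. \<sigma> k (fst z) (snd z) $ i)"
    and ell_C1: "\<forall>k<N. C1_map (\<lambda>z. ell k (fst z) (snd z))"
    and \<Phi>_C1: "C1_map \<Phi>"
    and c1: "c1 > 0" and c2: "(c2::real) > 0"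
    and b_growth: "\<forall>k<N. \<forall>x u. norm (b k x u) \<le> c1 * (1 + norm x + norm u)
                     \<and> onorm (Dx (b k) x u) + onorm (Du (b k) x u) \<le> c1"
    and \<sigma>_growth: "\<forall>k<N. \<forall>i x u. norm (\<sigma> k x u $ i) \<le> c1 * (1 + norm x + norm u)
                     \<and> onorm (Dx (\<lambda>x u. \<sigma> k x u $ i) x u) + onorm (Du (\<lambda>x u. \<sigma> k x u $ i) x u) \<le> c1"
    and ell_growth: "\<forall>k<N. \<forall>x u. \<bar>ell k x u\<bar> \<le> c2 * (1 + norm x + norm u)\<^sup>2
                     \<and> onorm (Dx (ell k) x u) + onorm (Du (ell k) x u) \<le> c2 * (1 + norm x + norm u)"
    and \<Phi>_growth: "\<forall>x. \<bar>\<Phi> x\<bar> \<le> c2 * (1 + norm x)\<^sup>2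
                     \<and> onorm (frechet_derivative \<Phi> (at x)) \<le> c2 * (1 + norm x)"
    and U_set: "ctrl_set M w N U"
    and U_ne: "U \<noteq> {}"
    and U_closed: "closed_ctrl M w N U"
    and loc: "local_solution M w N b \<sigma> ell \<Phi> x0 U xb ub"
  shows "\<exists>p :: nat \<Rightarrow> 'a \<Rightarrow> real^'n. \<exists>q :: nat \<Rightarrow> 'a \<Rightarrow> real^'n^'d.
     (\<forall>k<N. L2 M (filt M w k) (p k) \<and> L2 M (filt M w k) (q k)) \<and>
     (\<forall>k\<in>{1..N-1}.
        (AE \<omega> in M. p (k-1) \<omega> = cond_exp_vec M (filt M w (k-1))
            (\<lambda>\<omega>'. gradx_Ham ell b \<sigma> k (xb k \<omega>') (p k \<omega>') (q k \<omega>') (ub k \<omega>')) \<omega>) \<and>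
        (\<forall>i. AE \<omega> in M. q (k-1) \<omega> $ i = cond_exp_vec M (filt M w (k-1))
            (\<lambda>\<omega>'. (w k \<omega>' $ i) *\<^sub>R gradx_Ham ell b \<sigma> k (xb k \<omega>') (p k \<omega>') (q k \<omega>') (ub k \<omega>')) \<omega>)) \<and>
     (AE \<omega> in M. p (N-1) \<omega> = cond_exp_vec M (filt M w (N-1)) (\<lambda>\<omega>'. grad \<Phi> (xb N \<omega>')) \<omega>) \<and>
     (\<forall>i. AE \<omega> in M. q (N-1) \<omega> $ i = cond_exp_vec M (filt M w (N-1))
            (\<lambda>\<omega>'. (w N \<omega>' $ i) *\<^sub>R grad \<Phi> (xb N \<omega>')) \<omega>) \<and>
     (\<forall>v\<in>clarke_cone M w N U ub.
        (\<integral>\<omega>. (\<Sum>k<N. gradu_Ham ell b \<sigma> k (xb k \<omega>) (p k \<omega>) (q k \<omega>) (ub k \<omega>) \<bullet> v k \<omega>) \<partial>M) \<ge> 0) \<and>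
     (convex_ctrl (contingent_cone M w N U ub) \<longrightarrow>
        (\<forall>v\<in>contingent_cone M w N U ub.
        (\<integral>\<omega>. (\<Sum>k<N. gradu_Ham ell b \<sigma> k (xb k \<omega>) (p k \<omega>) (q k \<omega>) (ub k \<omega>) \<bullet> v k \<omega>) \<partial>M) \<ge> 0))"
proof -
  interpret prob_space M by (rule P)
  \<comment> \<open>The derivatives are chosen separately for each time and column. For
    \<open>k\<close> at or beyond \<open>N\<close> the choice is an arbitrary value, and the locale
    demands nothing there.\<close>
  define Db where "Db k = (SOME D. bounded_C1 (\<lambda>z. b k (fst z) (snd z)) D (\<lambda>z. c1))" for k
  define Ds where "Ds k i = (SOME D. bounded_C1 (\<lambda>z. \<sigma> k (fst z) (snd z) $ i) D (\<lambda>z. c1))" for k i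
  define Dl where "Dl k = (SOME D. bounded_C1 (\<lambda>z. ell k (fst z) (snd z)) D
    (\<lambda>z. c2 * (1 + norm (fst z) + norm (snd z))))" for k
  have Db: "bounded_C1 (\<lambda>z. b k (fst z) (snd z)) (Db k) (\<lambda>z. c1)" if "k < N" for k
    unfolding Db_def
    by (rule someI_ex[OF C1_map_partials[where f="b k" and B="\<lambda>_ _. c1"]]) (use b_C1 b_growth that in auto)
  have Ds: "bounded_C1 (\<lambda>z. \<sigma> k (fst z) (snd z) $ i) (Ds k i) (\<lambda>z. c1)" if "k < N" for k i
    unfolding Ds_def
    by (rule someI_ex[OF C1_map_partials[where f="\<lambda>x u. \<sigma> k x u $ i" and B="\<lambda>_ _. c1"]])
      (use \<sigma>_C1 \<sigma>_growth that in auto)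
  have Dl: "bounded_C1 (\<lambda>z. ell k (fst z) (snd z)) (Dl k) (\<lambda>z. c2 * (1 + norm (fst z) + norm (snd z)))"
    if "k < N" for k
    unfolding Dl_def
    by (rule someI_ex[OF C1_map_partials[where f="ell k" and B="\<lambda>x u. c2 * (1 + norm x + norm u)"]])
      (use ell_C1 ell_growth that in auto)
  obtain DP where DP: "\<And>x. (\<Phi> has_derivative blinfun_apply (DP x)) (at x)" "continuous_on UNIV DP"
    using \<Phi>_C1 by (auto simp: C1_map_def)
  have DP_le: "norm (DP x) \<le> c2 * (1 + norm x)" for x
    using \<Phi>_growth frechet_derivative_at[OF DP(1)[of x]] by (auto simp: norm_blinfun.rep_eq)
  \<comment> \<open>The factor 2 comes from passing to the norm of the pair: each component is
    bounded by it, so \<open>1 + norm x + norm u\<close> is at most twice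
    \<open>1 + norm (x, u)\<close>. Adding \<open>c1\<close> covers the bounds on drift and
    diffusion as well.\<close>
  define c where "c = c1 + 2 * c2"
  have Dl_le: "norm (Dl k z) \<le> c * (1 + norm z)" if "k < N" for k z
  proof -
    have "norm (Dl k z) \<le> c2 * (1 + norm (fst z) + norm (snd z))" using bounded_C1D(3)[OF Dl[OF that]] .
    also have "\<dots> \<le> c2 * (2 * (1 + norm z))"
      using c2 norm_fst_le[of "fst z" "snd z"] norm_snd_le[of "snd z" "fst z"] by (intro mult_left_mono) auto
    also have "\<dots> \<le> c * (1 + norm z)"
      using mult_nonneg_nonneg[of c1 "1 + norm z"] c1 by (simp add: c_def algebra_simps)
    finally show ?thesis .
  qed
  interpret controlled_system M w N x0 b \<sigma> ell \<Phi> Db Ds Dl DP c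
  proof
    show "prob_space.indep_vars M (\<lambda>_. borel) w {1..N}" by (rule w_indep)
    show "norm (DP x) \<le> c * (1 + norm x)" for x
    proof -
      have "c2 * (1 + norm x) \<le> c * (1 + norm x)" using c1 c2 by (intro mult_right_mono) (auto simp: c_def)
      with DP_le[of x] show ?thesis by linarith
    qed
    show "norm (Db k z) \<le> c" "norm (Ds k i z) \<le> c" if "k < N" for k z i
    proof -
      have "norm (Db k z) \<le> c1" "norm (Ds k i z) \<le> c1"
        using bounded_C1D(3)[OF Db[OF that]] bounded_C1D(3)[OF Ds[OF that]] .
      then show "norm (Db k z) \<le> c" "norm (Ds k i z) \<le> c" using c2 by (simp_all add: c_def)
    qed
    show "c \<ge> 0" using c1 c2 by (simp add: c_def)
  qed (use w_var in \<open>auto intro: Dl_le DP bounded_C1D(1,2)[OF Db] bounded_C1D(1,2)[OF Ds] bounded_C1D(1,2)[OF Dl]\<close>)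
  from maximum_principle[OF N U_set loc] show ?thesis
    by (elim exE conjE, intro exI conjI impI) assumption+
qed

end
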